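(* Let $F(n)=2(2n^2+3n-2)^2(2n^2+4n-1)$. Let $G$ be a finitely generated group which is neither generalized dicyclic nor abelian. (1) If $G$ contains an element of order at least $F(32\operatorname{rank}(G)^{6})$, then it has a GRR of valency at most $32\operatorname{rank}(G)^{6}$. (2) If $G$ has no elements of order $4$ or no non-trivial characteristic abelian subgroups, then this bound can be lowered: if $G$ contains an element of order at least $F(18\operatorname{rank}(G)^2+84\operatorname{rank}(G)-4)$, then $G$ has a GRR of valency at most $18\operatorname{rank}(G)^2+84\operatorname{rank}(G)$. (3) If moreover $G$ has elements of arbitrarily large order, then for every finite generating set $S$ there exists a symmetric set $T$ containing $S$ such that $\mathrm{Cay}(G,T)$ is a GRR for $G$ with $|T|\leq 32|S|^6$, or with $|T|\leq 18|S|^2+84|S|$ if $G$ has no elements of order $4$ or no non-trivial characteristic abelian subgroups.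
   Context: Generating sets never contain the identity. $\mathrm{Cay}(G,S)$ is the simple undirected graph with vertex set $G$ and edge set $\{(g,h)\mid g^{-1}h\in S\cup S^{-1}\}$. It is a graphical regular representation (GRR) of $G$ if its only automorphisms are the left multiplications by elements of $G$. $\operatorname{rank}(G)$ is the smallest cardinality of a generating set of $G$. A set $T$ is symmetric if $T=T^{-1}$. Elements of infinite order count as having order at least any given number. A group is generalized dicyclic if it is non-abelian and has an abelian normal subgroup $A$ of index $2$ and an element $x\notin A$ of order $4$ with $xax^{-1}=a^{-1}$ for every $a\in A$. *)

theory Defs
  imports "HOL-Algebra.Algebra" "Graph_Theory.Pair_Digraph"
begin

section \<open>Group-theoretic notions\<close>

text \<open>As a convention, generating sets never contain the identity.\<close>

definition generating_set :: "('a, 'b) monoid_scheme \<Rightarrow> 'a set \<Rightarrow> bool" where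
  "generating_set G S \<longleftrightarrow> S \<subseteq> carrier G - {\<one>\<^bsub>G\<^esub>} \<and> generate G S = carrier G"

definition finitely_generated :: "('a, 'b) monoid_scheme \<Rightarrow> bool" where
  "finitely_generated G \<longleftrightarrow> (\<exists>S. finite S \<and> generating_set G S)"

text \<open>Only meaningful for finitely generated groups.\<close>

definition group_rank :: "('a, 'b) monoid_scheme \<Rightarrow> nat" where
  "group_rank G = (LEAST n. \<exists>S. finite S \<and> generating_set G S \<and> card S = n)"

definition symmetric_set :: "('a, 'b) monoid_scheme \<Rightarrow> 'a set \<Rightarrow> bool" where
  "symmetric_set G T \<longleftrightarrow> T = set_inv\<^bsub>G\<^esub> T"

text \<open>\<^const>\<open>group.ord\<close> is \<open>0\<close> exactly on the elements of infinite order.\<close>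

definition order_at_least :: "('a, 'b) monoid_scheme \<Rightarrow> 'a \<Rightarrow> int \<Rightarrow> bool" where
  "order_at_least G x N \<longleftrightarrow> group.ord G x = 0 \<or> N \<le> int (group.ord G x)"

definition abelian_subgroup :: "('a, 'b) monoid_scheme \<Rightarrow> 'a set \<Rightarrow> bool" where
  "abelian_subgroup G H \<longleftrightarrow> subgroup H G \<and> comm_group (G\<lparr>carrier := H\<rparr>)"

definition characteristic_subgroup :: "('a, 'b) monoid_scheme \<Rightarrow> 'a set \<Rightarrow> bool" where
  "characteristic_subgroup G H \<longleftrightarrow> subgroup H G \<and> (\<forall>\<phi> \<in> iso G G. \<phi> ` H = H)"

definition generalized_dicyclic :: "('a, 'b) monoid_scheme \<Rightarrow> bool" where
  "generalized_dicyclic G \<longleftrightarrow> group G \<and> \<not> comm_group G \<and>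
     (\<exists>A x. abelian_subgroup G A \<and> A \<lhd> G \<and> card (rcosets\<^bsub>G\<^esub> A) = 2 \<and>
        x \<in> carrier G - A \<and> group.ord G x = 4 \<and>
        (\<forall>a \<in> A. x \<otimes>\<^bsub>G\<^esub> a \<otimes>\<^bsub>G\<^esub> inv\<^bsub>G\<^esub> x = inv\<^bsub>G\<^esub> a))"

definition no_order_4_or_no_char_abelian :: "('a, 'b) monoid_scheme \<Rightarrow> bool" where
  "no_order_4_or_no_char_abelian G \<longleftrightarrow>
     \<not> (\<exists>x \<in> carrier G. group.ord G x = 4) \<or>
     \<not> (\<exists>H. H \<noteq> {\<one>\<^bsub>G\<^esub>} \<and> characteristic_subgroup G H \<and> abelian_subgroup G H)"


section \<open>Cayley graphs\<close>

text \<open>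
  A simple undirected graph is encoded by its vertex set and its symmetric irreflexive
  adjacency relation.
\<close>

definition cayley_graph :: "('a, 'b) monoid_scheme \<Rightarrow> 'a set \<Rightarrow> 'a pair_pre_digraph" where
  "cayley_graph G S =
     \<lparr> pverts = carrier G,
       parcs = {(g, h) \<in> carrier G \<times> carrier G. inv\<^bsub>G\<^esub> g \<otimes>\<^bsub>G\<^esub> h \<in> S \<union> set_inv\<^bsub>G\<^esub> S} \<rparr>"

lemma cayley_graph_simple_undirected:
  fixes G (structure)
  assumes "group G" and S: "S \<subseteq> carrier G - {\<one>\<^bsub>G\<^esub>}"
  shows "pair_bidirected_digraph (cayley_graph G S)"
proof -
  interpret group G by fact
  have sym: "inv h \<otimes> g \<in> S \<union> set_inv S"
    if gh: "g \<in> carrier G" "h \<in> carrier G" and mem: "inv g \<otimes> h \<in> S \<union> set_inv S" for g h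
  proof -
    have "inv h \<otimes> g = inv (inv g \<otimes> h)"
      using gh by (simp add: inv_mult_group)
    moreover have "inv (inv g \<otimes> h) \<in> S \<union> set_inv S"
      using mem
    proof
      assume "inv g \<otimes> h \<in> S"
      then show ?thesis by (auto simp only: SET_INV_def)
    next
      assume "inv g \<otimes> h \<in> set_inv S"
      then obtain s where "s \<in> S" "inv g \<otimes> h = inv s" by (auto simp only: SET_INV_def)
      then show ?thesis using S by auto
    qed
    ultimately show ?thesis by simp
  qed
  have one: "\<one> \<notin> S \<union> set_inv S"
  proof
    assume "\<one> \<in> S \<union> set_inv S"
    then obtain s where "s \<in> S" "s = \<one> \<or> inv s = \<one>"
      by (auto simp: SET_INV_def)
    then show False using S inv_eq_1_iff by blast
  qed
  show ?thesis
  proof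
    show "symmetric (with_proj (cayley_graph G S))"
      unfolding symmetric_def
    proof (rule symI)
      fix g h
      assume "(g, h) \<in> arcs_ends (with_proj (cayley_graph G S))"
      then show "(h, g) \<in> arcs_ends (with_proj (cayley_graph G S))"
        using sym[of g h] by (simp add: cayley_graph_def)
    qed
  next
    fix e
    assume "e \<in> parcs (cayley_graph G S)"
    then show "fst e \<in> pverts (cayley_graph G S)" "snd e \<in> pverts (cayley_graph G S)"
      "fst e \<noteq> snd e"
      using one by (auto simp: cayley_graph_def)
  qed
qed

text \<open>
  \<^const>\<open>Bij\<close> consists of extensional bijections, so that distinct elements are
  distinct permutations of the vertices.
\<close>

definition graph_automorphisms :: "'a pair_pre_digraph \<Rightarrow> ('a \<Rightarrow> 'a) set" where
  "graph_automorphisms \<Gamma> =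
     {\<phi> \<in> Bij (pverts \<Gamma>). \<forall>u \<in> pverts \<Gamma>. \<forall>v \<in> pverts \<Gamma>.
        (\<phi> u, \<phi> v) \<in> parcs \<Gamma> \<longleftrightarrow> (u, v) \<in> parcs \<Gamma>}"

definition left_multiplications :: "('a, 'b) monoid_scheme \<Rightarrow> ('a \<Rightarrow> 'a) set" where
  "left_multiplications G = (\<lambda>g. \<lambda>h \<in> carrier G. g \<otimes>\<^bsub>G\<^esub> h) ` carrier G"

text \<open>For a symmetric relation, the out-degree is the valency of the undirected graph.\<close>

definition has_valency :: "'a pair_pre_digraph \<Rightarrow> nat \<Rightarrow> bool" where
  "has_valency \<Gamma> d \<longleftrightarrow>
     (\<forall>v \<in> pverts \<Gamma>. finite (out_arcs (with_proj \<Gamma>) v) \<and> out_degree (with_proj \<Gamma>) v = d)"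

definition cayley_is_GRR :: "('a, 'b) monoid_scheme \<Rightarrow> 'a set \<Rightarrow> bool" where
  "cayley_is_GRR G S \<longleftrightarrow>
     generating_set G S \<and> graph_automorphisms (cayley_graph G S) = left_multiplications G"

definition has_GRR_of_valency_at_most :: "('a, 'b) monoid_scheme \<Rightarrow> nat \<Rightarrow> bool" where
  "has_GRR_of_valency_at_most G k \<longleftrightarrow>
     (\<exists>S d. cayley_is_GRR G S \<and> has_valency (cayley_graph G S) d \<and> d \<le> k)"

definition F :: "int \<Rightarrow> int" where
  "F n = 2 * (2 * n^2 + 3 * n - 2)^2 * (2 * n^2 + 4 * n - 1)"

end

(*
  Let W be a finite symmetric set of words containing the generating set S. Call a bijection f of G
  a colour map if f(gw) is f(g)w or f(g)w^-1 for all g in G and w in W.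

  Colours are made visible to automorphisms by counting triangles. Let h have large order. For w in
  W and a suitable power a of h, adding a, b = a^-1 w and their inverses to the connection set
  creates the triangle w = ab and changes the number of triangles at no other old edge, with the
  sole exception of w^2 when w inverts a. Repeating this separates the numbers of triangles at all
  w in W from each other and from those at the new elements (which are at most 4), so every
  automorphism of the resulting Cayley graph is a colour map for W. With m words up to inversion
  the connection set has at most 2 m^2 + 20 m elements.

  It remains to find few words such that colour maps fixing the identity fix S pointwise. If a
  colour map inverts x and fixes f, then the word x^-1 f forces x to invert f by conjugation; if it
  inverts x and y, then the word x^-1 y forces x^2 = y^2 or xy = yx. A bounded number of such words
  handles every element with non-trivial fourth power, in particular h. If some x with x^4 = 1 could
  then still be inverted whatever words are added, the centralizer of h would be abelian of index 2
  and inverted by x, so G would be generalized dicyclic. Under the hypotheses of (2) one can already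
  fix two non-commuting elements, one of them in S, with five words; every further generator is
  then handled by two words, which gives m = 2|S| + 3 instead of m = 7(|S| + 1).
*)

theory Submission
  imports Defs
begin

section \<open>Elements inverted by conjugation\<close>

context group
begin

lemma mult_inv_cancel: "x \<in> carrier G \<Longrightarrow> y \<in> carrier G \<Longrightarrow> x \<otimes> (inv x \<otimes> y) = y"
  by (simp add: m_assoc[symmetric])

lemma inv_mult_cancel: "x \<in> carrier G \<Longrightarrow> y \<in> carrier G \<Longrightarrow> inv x \<otimes> (x \<otimes> y) = y"
  by (simp add: m_assoc[symmetric])

lemmas group_word_simps = m_assoc inv_mult_group mult_inv_cancel inv_mult_cancel

lemma mult_both_sides: "l = r \<Longrightarrow> p \<otimes> l \<otimes> q = p \<otimes> r \<otimes> q"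
  by simp

text \<open>Equivalent to conjugation by \<open>x\<close> sending \<open>f\<close> to its inverse.
  In this product form the relation can be read off directly from an edge between a flipped
  \<open>x\<close> and a fixed \<open>f\<close>.\<close>

definition inverts :: "'a \<Rightarrow> 'a \<Rightarrow> bool" where
  "inverts x f \<longleftrightarrow> x \<otimes> f = inv f \<otimes> x"

lemma eq_inv_iff_square:
  assumes [simp]: "x \<in> carrier G"
  shows "x = inv x \<longleftrightarrow> x \<otimes> x = \<one>"
  by (metis assms inv_closed r_inv inv_unique')

lemma inv_commute_iff:
  assumes [simp]: "x \<in> carrier G" "g \<in> carrier G"
  shows "inv x \<otimes> g = g \<otimes> inv x \<longleftrightarrow> x \<otimes> g = g \<otimes> x"
proof -
  have *: "y \<otimes> g = g \<otimes> y" if e: "inv y \<otimes> g = g \<otimes> inv y" and [simp]: "y \<in> carrier G" for y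
  proof -
    have "y \<otimes> g = y \<otimes> (g \<otimes> inv y) \<otimes> y" by (simp add: group_word_simps)
    also have "\<dots> = g \<otimes> y" unfolding e[symmetric] by (simp add: group_word_simps)
    finally show ?thesis .
  qed
  show ?thesis using *[of x] *[of "inv x"] by auto
qed

text \<open>Conjugating by \<open>x\<close> twice inverts \<open>f\<close> twice.\<close>

lemma inverts_square_commutes:
  assumes [simp]: "x \<in> carrier G" "f \<in> carrier G" and i: "inverts x f"
  shows "x \<otimes> x \<otimes> f = f \<otimes> (x \<otimes> x)"
proof -
  have e: "x \<otimes> f = inv f \<otimes> x" using i by (simp add: inverts_def)
  have "x \<otimes> inv f = f \<otimes> x"
    using mult_both_sides[OF e, of f "inv f"] by (simp add: group_word_simps)
  with e show ?thesis by (metis assms(1,2) inv_closed m_assoc)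
qed

lemma inverts_inv:
  assumes [simp]: "x \<in> carrier G" "f \<in> carrier G" and i: "inverts x f"
  shows "inverts x (inv f)"
proof -
  have e: "x \<otimes> f = inv f \<otimes> x" using i by (simp add: inverts_def)
  have "x \<otimes> inv f = f \<otimes> (inv f \<otimes> x) \<otimes> inv f" by (simp add: group_word_simps)
  also have "\<dots> = f \<otimes> x" unfolding e[symmetric] by (simp add: group_word_simps)
  finally show ?thesis by (simp add: inverts_def)
qed

lemma inverts_inv_left:
  assumes [simp]: "x \<in> carrier G" "h \<in> carrier G" and "inverts x h"
  shows "inverts (inv x) h"
proof -
  have e: "x \<otimes> inv h = h \<otimes> x" using inverts_inv[OF assms] by (simp add: inverts_def)
  have "inv x \<otimes> h = inv x \<otimes> (h \<otimes> x) \<otimes> inv x" by (simp add: group_word_simps)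
  also have "\<dots> = inv h \<otimes> inv x" unfolding e[symmetric] by (simp add: group_word_simps)
  finally show ?thesis by (simp add: inverts_def)
qed

text \<open>Conjugation is multiplicative, so the inverse of the product equals the product of the
  inverses in the same order. Read contrapositively, \<open>x\<close> cannot invert all of
  \<open>f\<close>, \<open>g\<close>, \<open>f \<otimes> g\<close> when \<open>f\<close> and
  \<open>g\<close> do not commute.\<close>

lemma inverts_products_commute:
  assumes [simp]: "x \<in> carrier G" "f \<in> carrier G" "g \<in> carrier G"
    and "inverts x f" "inverts x g" "inverts x (f \<otimes> g)"
  shows "f \<otimes> g = g \<otimes> f"
proof -
  have "inv (f \<otimes> g) \<otimes> x = x \<otimes> f \<otimes> g"
    using assms(6) by (simp add: inverts_def m_assoc)
  also have "\<dots> = inv f \<otimes> (x \<otimes> g)" using assms(4) by (simp add: inverts_def m_assoc)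
  also have "\<dots> = inv f \<otimes> inv g \<otimes> x" using assms(5) by (simp add: inverts_def m_assoc)
  finally have "inv (f \<otimes> g) = inv (g \<otimes> f)" by (simp add: inv_mult_group)
  then show ?thesis by (metis assms(2,3) inv_inv m_closed)
qed

lemma inverts_commuting:
  assumes [simp]: "x \<in> carrier G" "f \<in> carrier G" and "inverts x f" "x \<otimes> f = f \<otimes> x"
  shows "f \<otimes> f = \<one>"
proof -
  have "f \<otimes> x = inv f \<otimes> x" using assms(3,4) by (simp add: inverts_def)
  then show ?thesis by (metis assms(1,2) inv_closed r_cancel eq_inv_iff_square)
qed

text \<open>The two relations give u^2 = t^2, as in the quaternion group. Hence \<open>u\<close>
  both inverts and commutes with t^2, so the square of t^2 is trivial.\<close>

lemma mutually_inverting: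
  assumes [simp]: "t \<in> carrier G" "u \<in> carrier G" and "inverts t u" "inverts u t"
  shows "t \<otimes> t \<otimes> (t \<otimes> t) = \<one>"
proof -
  have e1: "t \<otimes> u = inv u \<otimes> t" and e2: "u \<otimes> t = inv t \<otimes> u"
    using assms(3,4) by (simp_all add: inverts_def)
  have "u \<otimes> t \<otimes> u = t"
    using mult_both_sides[OF e1, of u \<one>] by (simp add: group_word_simps)
  then have "inv t \<otimes> (u \<otimes> u) = t" using e2 by (simp add: m_assoc)
  then have s: "u \<otimes> u = t \<otimes> t"
    by (metis assms(1,2) inv_solve_left m_closed)
  have "u \<otimes> (t \<otimes> t) = (inv t \<otimes> u) \<otimes> t" using e2 by (simp add: m_assoc[symmetric])
  also have "\<dots> = inv t \<otimes> (inv t \<otimes> u)" using e2 by (simp add: m_assoc)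
  finally have "inverts u (t \<otimes> t)" by (simp add: inverts_def group_word_simps)
  moreover have "u \<otimes> (t \<otimes> t) = t \<otimes> t \<otimes> u" by (simp add: s[symmetric] m_assoc)
  ultimately show ?thesis by (intro inverts_commuting[of u]) simp_all
qed

section \<open>Maps preserving unoriented colours\<close>

definition colour_maps :: "'a set \<Rightarrow> ('a \<Rightarrow> 'a) set" where
  "colour_maps W = {\<phi>. bij_betw \<phi> (carrier G) (carrier G) \<and>
     (\<forall>g \<in> carrier G. \<forall>w \<in> W. \<phi> (g \<otimes> w) \<in> {\<phi> g \<otimes> w, \<phi> g \<otimes> inv w})}"

text \<open>The condition looks only at the identity; \<open>pinsD\<close> carries it to every
  vertex by left translation. The element \<open>x\<close> need not itself be a word of
  \<open>W\<close>.\<close>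

definition pins :: "'a set \<Rightarrow> 'a \<Rightarrow> bool" where
  "pins W x \<longleftrightarrow> (\<forall>\<phi> \<in> colour_maps W. \<phi> \<one> = \<one> \<longrightarrow> \<phi> x = x)"

lemma pins_mono: "pins W x \<Longrightarrow> W \<subseteq> W' \<Longrightarrow> pins W' x"
  unfolding pins_def colour_maps_def by blast

lemma colour_map_closed:
  "\<phi> \<in> colour_maps W \<Longrightarrow> g \<in> carrier G \<Longrightarrow> \<phi> g \<in> carrier G"
  unfolding colour_maps_def by (auto dest: bij_betwE)

text \<open>Colours are read off by right multiplication, so left translations on either side
  preserve them. This choice of translations yields a map that fixes the identity.\<close>

lemma colour_map_shift:
  assumes f: "\<phi> \<in> colour_maps W" and g: "g \<in> carrier G" and W: "W \<subseteq> carrier G"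
  shows "(\<lambda>k. inv (\<phi> g) \<otimes> \<phi> (g \<otimes> k)) \<in> colour_maps W"
proof -
  have bij: "bij_betw \<phi> (carrier G) (carrier G)" using f by (simp add: colour_maps_def)
  have tr: "bij_betw (\<lambda>k. a \<otimes> k) (carrier G) (carrier G)" if a: "a \<in> carrier G" for a
    by (rule bij_betw_byWitness[where f' = "\<lambda>k. inv a \<otimes> k"])
      (use a in \<open>auto simp: mult_inv_cancel inv_mult_cancel\<close>)
  have "bij_betw ((\<lambda>k. inv (\<phi> g) \<otimes> k) \<circ> (\<phi> \<circ> (\<lambda>k. g \<otimes> k))) (carrier G) (carrier G)"
    by (intro bij_betw_trans[OF bij_betw_trans[OF tr[OF g] bij]] tr)
      (use colour_map_closed[OF f g] in simp)
  moreover have "inv (\<phi> g) \<otimes> \<phi> (g \<otimes> (k \<otimes> w)) \<in>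
      {inv (\<phi> g) \<otimes> \<phi> (g \<otimes> k) \<otimes> w, inv (\<phi> g) \<otimes> \<phi> (g \<otimes> k) \<otimes> inv w}"
    if k: "k \<in> carrier G" and w: "w \<in> W" for k w
  proof -
    have [simp]: "w \<in> carrier G" using w W by blast
    have "\<phi> (g \<otimes> k \<otimes> w) \<in> {\<phi> (g \<otimes> k) \<otimes> w, \<phi> (g \<otimes> k) \<otimes> inv w}"
      using f g k w by (simp add: colour_maps_def)
    then show ?thesis
      using g k colour_map_closed[OF f] by (auto simp: m_assoc)
  qed
  ultimately show ?thesis by (simp add: colour_maps_def comp_def)
qed

lemma pinsD:
  assumes "pins W x" "\<phi> \<in> colour_maps W" "g \<in> carrier G" "x \<in> carrier G" "W \<subseteq> carrier G"
  shows "\<phi> (g \<otimes> x) = \<phi> g \<otimes> x"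
proof -
  have c: "\<phi> g \<in> carrier G" "\<phi> (g \<otimes> x) \<in> carrier G"
    using assms colour_map_closed by auto
  have "inv (\<phi> g) \<otimes> \<phi> (g \<otimes> x) = x"
    using bspec[OF assms(1)[unfolded pins_def] colour_map_shift[OF assms(2,3,5)]] assms(3) c
    by simp
  then show ?thesis using c assms(4) by (metis inv_solve_left)
qed

lemma pins_mult:
  assumes "pins W x" "pins W y" "x \<in> carrier G" "y \<in> carrier G" "W \<subseteq> carrier G"
  shows "pins W (x \<otimes> y)"
  using pinsD[OF assms(2) _ assms(3,4,5)] assms(1) unfolding pins_def by metis

text \<open>A word has only two possible images, itself and its inverse, so it remains to refute a
  genuine flip.\<close>

lemma pinsI:
  assumes "x \<in> W"
    and "\<And>\<phi>. \<phi> \<in> colour_maps W \<Longrightarrow> \<phi> \<one> = \<one> \<Longrightarrow> \<phi> x = inv x \<Longrightarrow> x \<noteq> inv x \<Longrightarrow> False"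
    and "W \<subseteq> carrier G"
  shows "pins W x"
  unfolding pins_def
proof (intro ballI impI)
  fix \<phi> assume f: "\<phi> \<in> colour_maps W" "\<phi> \<one> = \<one>"
  have "\<phi> (\<one> \<otimes> x) \<in> {\<phi> \<one> \<otimes> x, \<phi> \<one> \<otimes> inv x}"
    using f(1) assms(1) unfolding colour_maps_def by blast
  then have "\<phi> x \<in> {x, inv x}" using f(2) assms(1,3) by auto
  then show "\<phi> x = x" using assms(2)[OF f] by fastforce
qed

lemma pins_involution: "x \<in> W \<Longrightarrow> W \<subseteq> carrier G \<Longrightarrow> x \<otimes> x = \<one> \<Longrightarrow> pins W x"
  by (rule pinsI) (use eq_inv_iff_square in auto)

end

locale normalised_colour_map = group G for G (structure) +
  fixes W \<phi>
  assumes W: "W \<subseteq> carrier G" and colour: "\<phi> \<in> colour_maps W" and \<phi>_one: "\<phi> \<one> = \<one>"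
begin

lemma \<phi>_closed [simp]: "g \<in> carrier G \<Longrightarrow> \<phi> g \<in> carrier G"
  by (rule colour_map_closed[OF colour])

lemma \<phi>_inj: "g \<in> carrier G \<Longrightarrow> k \<in> carrier G \<Longrightarrow> \<phi> g = \<phi> k \<Longrightarrow> g = k"
  using colour by (auto simp: colour_maps_def bij_betw_def inj_on_def)

lemma W_carrier: "w \<in> W \<Longrightarrow> w \<in> carrier G"
  using W by blast

text \<open>If the quotient of two vertices is a word, they span an edge of known colour, and the
  image edge has the same colour up to orientation. All later constraints come from applying this to
  triangles through the identity.\<close>

lemma edge:
  assumes [simp]: "g \<in> carrier G" "k \<in> carrier G" and w: "inv g \<otimes> k \<in> W"
  shows "inv (\<phi> g) \<otimes> \<phi> k \<in> {inv g \<otimes> k, inv k \<otimes> g}"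
proof -
  have "\<phi> (g \<otimes> (inv g \<otimes> k)) \<in> {\<phi> g \<otimes> (inv g \<otimes> k), \<phi> g \<otimes> inv (inv g \<otimes> k)}"
    using colour w assms(1) unfolding colour_maps_def by blast
  then show ?thesis by (auto simp: group_word_simps)
qed

lemma \<phi>_cases: "w \<in> W \<Longrightarrow> \<phi> w = w \<or> \<phi> w = inv w"
  using edge[of \<one> w] by (auto simp: \<phi>_one W_carrier)

text \<open>The edge from \<open>inv w\<close> to \<open>\<one>\<close> has colour \<open>w\<close>,
  leaving two candidates for the image; injectivity excludes the one already taken by
  \<open>w\<close>.\<close>

lemma flip_inv:
  assumes "w \<in> W" "\<phi> w = inv w"
  shows "\<phi> (inv w) = w"
proof (cases "w = inv w")
  case False
  have "inv (\<phi> (inv w)) \<otimes> \<phi> \<one> \<in> {w, inv w}"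
    using edge[of "inv w" \<one>] assms(1) W_carrier by simp
  then have "\<phi> (inv w) \<in> {inv w, w}"
    using W_carrier[OF assms(1)] by (auto simp: \<phi>_one) (metis \<phi>_closed inv_closed inv_inv)+
  moreover have "\<phi> (inv w) \<noteq> inv w"
    using \<phi>_inj[of "inv w" w] W_carrier[OF assms(1)] assms(2) False by fastforce
  ultimately show ?thesis by blast
qed (use assms W_carrier in simp)

text \<open>The edge from \<open>x\<close> to \<open>f\<close> is mapped to the edge from
  \<open>inv x\<close> to \<open>f\<close>, whose label is \<open>x \<otimes> f\<close>. It cannot
  keep its orientation, since that would give \<open>x = inv x\<close>.\<close>

lemma fixed_inverted:
  assumes [simp]: "x \<in> carrier G" "f \<in> carrier G"
    and "\<phi> x = inv x" "x \<noteq> inv x" "\<phi> f = f" "inv x \<otimes> f \<in> W"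
  shows "inverts x f"
proof -
  have "x \<otimes> f \<in> {inv x \<otimes> f, inv f \<otimes> x}" using edge[of x f] assms by simp
  moreover have "x \<otimes> f \<noteq> inv x \<otimes> f" using assms(4) by (metis assms(1,2) inv_closed r_cancel)
  ultimately show ?thesis by (auto simp: inverts_def)
qed

text \<open>The image edge runs from \<open>inv x\<close> to \<open>inv y\<close> and has label
  \<open>x \<otimes> inv y\<close>. Kept orientation gives equal squares, reversed orientation gives
  commutation.\<close>

lemma flipped_pair:
  assumes [simp]: "x \<in> carrier G" "y \<in> carrier G"
    and "\<phi> x = inv x" "\<phi> y = inv y" "inv x \<otimes> y \<in> W"
  shows "x \<otimes> x = y \<otimes> y \<or> x \<otimes> y = y \<otimes> x"
proof -
  have "x \<otimes> inv y = inv x \<otimes> y \<or> x \<otimes> inv y = inv y \<otimes> x" using edge[of x y] assms by simp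
  then show ?thesis
  proof
    assume e: "x \<otimes> inv y = inv x \<otimes> y"
    have "x \<otimes> x = x \<otimes> (x \<otimes> inv y) \<otimes> y" by (simp add: group_word_simps)
    also have "\<dots> = y \<otimes> y" unfolding e by (simp add: group_word_simps)
    finally show ?thesis ..
  next
    assume e: "x \<otimes> inv y = inv y \<otimes> x"
    have "y \<otimes> x = y \<otimes> (x \<otimes> inv y) \<otimes> y" by (simp add: group_word_simps)
    also have "\<dots> = x \<otimes> y" unfolding e by (simp add: group_word_simps)
    finally show ?thesis by simp
  qed
qed

text \<open>The image of k^2 is joined to \<open>inv k\<close> by the colour \<open>k\<close>, so it
  is \<open>\<one>\<close> or the inverse of k^2, and \<open>\<one>\<close> is already the image of
  \<open>\<one>\<close>.\<close>

lemma flip_square: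
  assumes "k \<in> W" "k \<otimes> k \<in> W" "\<phi> k = inv k" "k \<noteq> inv k"
  shows "\<phi> (k \<otimes> k) = inv (k \<otimes> k)"
proof -
  have [simp]: "k \<in> carrier G" using assms W_carrier by simp
  have "inv (inv k) \<otimes> \<phi> (k \<otimes> k) \<in> {k, inv k}"
    using edge[of k "k \<otimes> k"] assms by (auto simp: group_word_simps)
  then have "\<phi> (k \<otimes> k) = \<one> \<or> \<phi> (k \<otimes> k) = inv k \<otimes> inv k"
    by simp (metis \<open>k \<in> carrier G\<close> \<phi>_closed inv_closed inv_solve_left l_inv m_closed inv_inv)
  moreover have "\<phi> (k \<otimes> k) \<noteq> \<one>"
    using \<phi>_inj[of "k \<otimes> k" \<one>] assms eq_inv_iff_square[of k] by (auto simp: \<phi>_one)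
  ultimately show ?thesis by (simp add: inv_mult_group)
qed

end

section \<open>Words that pin single elements\<close>

context group
begin

text \<open>If \<open>k\<close> does not invert \<open>y\<close>, four words suffice: flipping \<open>k\<close> forces \<open>y\<close> to be flipped, and
  the triangles on \<open>k, y\<close> and on \<open>inv k, y\<close> then give \<open>k\<^sup>2 = y\<^sup>2 = inv k\<^sup>2\<close>. Otherwise the word
  \<open>k\<^sup>2\<close>, which commutes with \<open>y\<close>, takes over.\<close>

lemma pins_noncentral:
  assumes [simp]: "k \<in> carrier G" "y \<in> carrier G"
    and ky: "k \<otimes> y \<noteq> y \<otimes> k" and k4: "k \<otimes> k \<otimes> (k \<otimes> k) \<noteq> \<one>"
  obtains ws where "length ws \<le> 5" "set ws \<subseteq> carrier G" "{k, y, inv k \<otimes> y} \<subseteq> set ws"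
    "pins (set ws) k"
proof (cases "inverts k y")
  case False
  let ?W = "{k, y, inv k \<otimes> y, k \<otimes> y}"
  have W: "?W \<subseteq> carrier G" by simp
  have "pins ?W k"
  proof (rule pinsI)
    fix \<phi> assume f: "\<phi> \<in> colour_maps ?W" "\<phi> \<one> = \<one>" "\<phi> k = inv k" "k \<noteq> inv k"
    interpret normalised_colour_map G ?W \<phi>
      by unfold_locales (use f W in auto)
    have "\<phi> y = inv y" using \<phi>_cases[of y] fixed_inverted[of k y] f(3,4) False by auto
    then have "k \<otimes> k = y \<otimes> y" "inv k \<otimes> inv k = y \<otimes> y"
      using flipped_pair[of k y] flipped_pair[of "inv k" y] flip_inv[of k] f(3) ky inv_commute_iff[of k y]
      by auto
    moreover have "inv (k \<otimes> k) = inv k \<otimes> inv k" by (simp add: inv_mult_group)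
    ultimately have "k \<otimes> k = inv (k \<otimes> k)" by argo
    then show False using k4 eq_inv_iff_square[of "k \<otimes> k"] by simp
  qed auto
  then show ?thesis by (intro that[of "[k, y, inv k \<otimes> y, k \<otimes> y]"]) auto
next
  case True
  let ?W = "{k, k \<otimes> k, y, inv k \<otimes> y, inv (k \<otimes> k) \<otimes> y}"
  have W: "?W \<subseteq> carrier G" by simp
  have "pins ?W k"
  proof (rule pinsI)
    fix \<phi> assume f: "\<phi> \<in> colour_maps ?W" "\<phi> \<one> = \<one>" "\<phi> k = inv k" "k \<noteq> inv k"
    interpret normalised_colour_map G ?W \<phi>
      by unfold_locales (use f W in auto)
    have kk: "\<phi> (k \<otimes> k) = inv (k \<otimes> k)" using flip_square[of k] f by simp
    have comm: "k \<otimes> k \<otimes> y = y \<otimes> (k \<otimes> k)" using True by (simp add: inverts_square_commutes)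
    show False
    proof (cases "\<phi> y = y")
      case fixed: True
      have "inverts (k \<otimes> k) y"
        using fixed_inverted[of "k \<otimes> k" y] kk fixed k4 eq_inv_iff_square[of "k \<otimes> k"] by auto
      then have "y \<otimes> y = \<one>" using inverts_commuting[of "k \<otimes> k" y] comm by simp
      then have "y = inv y" by (simp add: eq_inv_iff_square)
      then show False using True ky by (simp add: inverts_def)
    next
      case False
      then have "k \<otimes> k = y \<otimes> y"
        using \<phi>_cases[of y] flipped_pair[of k y] f(3) ky by auto
      \<comment> \<open>Since \<open>k\<close> inverts \<open>y\<close> it inverts y^2 = k^2; it
        also commutes with k^2, which would make its fourth power trivial.\<close>
      moreover have "inverts k (y \<otimes> y)"
      proof -
        have "k \<otimes> (y \<otimes> y) = k \<otimes> y \<otimes> y" by (simp add: m_assoc)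
        also have "\<dots> = inv y \<otimes> (k \<otimes> y)" using True by (simp add: inverts_def m_assoc)
        also have "\<dots> = inv (y \<otimes> y) \<otimes> k" using True by (simp add: inverts_def group_word_simps)
        finally show ?thesis by (simp add: inverts_def)
      qed
      ultimately have "inverts k (k \<otimes> k)" by simp
      then have "k \<otimes> k \<otimes> (k \<otimes> k) = \<one>" by (rule inverts_commuting[rotated 2]) (simp_all add: m_assoc)
      then show False using k4 by simp
    qed
  qed auto
  then show ?thesis
    by (intro that[of "[k, k \<otimes> k, y, inv k \<otimes> y, inv (k \<otimes> k) \<otimes> y]"]) auto
qed

text \<open>A flipped central \<open>x\<close> would invert, and also commute with, any fixed
  \<open>t\<close>, so \<open>t\<close> would be an involution; in every case \<open>t\<close>,
  \<open>u\<close> and \<open>inv x \<otimes> t\<close> are sent to their inverses. Neither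
  \<open>t\<close> nor \<open>inv x \<otimes> t\<close> commutes with \<open>u\<close>, so both have
  the same square as \<open>u\<close>, and comparing them gives x^2 = 1.\<close>

lemma pins_central:
  assumes [simp]: "x \<in> carrier G" "t \<in> carrier G" "u \<in> carrier G"
    and central: "\<And>g. g \<in> carrier G \<Longrightarrow> x \<otimes> g = g \<otimes> x"
    and tu: "t \<otimes> u \<noteq> u \<otimes> t"
  shows "pins {x, t, u, inv x \<otimes> t, inv x \<otimes> u, inv t \<otimes> u, inv (inv x \<otimes> t) \<otimes> u} x"
    (is "pins ?W x")
proof (rule pinsI)
  show W: "?W \<subseteq> carrier G" by simp
  fix \<phi> assume f: "\<phi> \<in> colour_maps ?W" "\<phi> \<one> = \<one>" "\<phi> x = inv x" "x \<noteq> inv x"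
  interpret normalised_colour_map G ?W \<phi>
    by unfold_locales (use f W in auto)
  \<comment> \<open>The choice \<open>y = inv x\<close> serves \<open>g = inv x \<otimes> t\<close>,
    for which the required word \<open>inv y \<otimes> g\<close> is \<open>t\<close> itself.\<close>
  have flip: "\<phi> g = inv g" if "y = x \<or> y = inv x" "g \<in> ?W" "inv y \<otimes> g \<in> ?W" for g y
  proof (rule ccontr)
    assume n: "\<phi> g \<noteq> inv g"
    have g [simp]: "g \<in> carrier G" using that W_carrier by blast
    have y: "y \<in> carrier G" "\<phi> y = inv y" "y \<noteq> inv y"
      using that(1) f(3,4) flip_inv[of x] by auto
    have "\<phi> g = g" using \<phi>_cases[OF that(2)] n by blast
    then have "inverts y g" using fixed_inverted[OF y(1) g y(2,3)] that(3) by blast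
    moreover have "y \<otimes> g = g \<otimes> y"
      using that(1) central[of g] inv_commute_iff[of x g] by auto
    ultimately have "g \<otimes> g = \<one>" using y(1) by (intro inverts_commuting[of y]) simp_all
    then have "g = inv g" by (simp only: eq_inv_iff_square[OF g])
    then show False using n \<open>\<phi> g = g\<close> by argo
  qed
  have xi: "x \<otimes> (inv x \<otimes> t) = t" by (simp add: mult_inv_cancel)
  have ft: "\<phi> t = inv t" by (rule flip[of x]) auto
  have fu: "\<phi> u = inv u" by (rule flip[of x]) auto
  have fxt: "\<phi> (inv x \<otimes> t) = inv (inv x \<otimes> t)" by (rule flip[of "inv x"]) (auto simp: xi)
  have "inv x \<otimes> t \<otimes> u \<noteq> u \<otimes> (inv x \<otimes> t)"
  proof
    assume e: "inv x \<otimes> t \<otimes> u = u \<otimes> (inv x \<otimes> t)"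
    have "t \<otimes> u = x \<otimes> (inv x \<otimes> t \<otimes> u)" by (simp add: group_word_simps)
    also have "\<dots> = x \<otimes> u \<otimes> (inv x \<otimes> t)" by (simp only: e) (simp add: m_assoc)
    also have "\<dots> = u \<otimes> t" using central[of u] by (simp add: group_word_simps)
    finally show False using tu by simp
  qed
  then have "t \<otimes> t = u \<otimes> u" "(inv x \<otimes> t) \<otimes> (inv x \<otimes> t) = u \<otimes> u"
    using flipped_pair[of t u] flipped_pair[of "inv x \<otimes> t" u] ft fu fxt tu by auto
  then have "inv x \<otimes> (t \<otimes> (inv x \<otimes> t)) = t \<otimes> t" by (simp add: m_assoc)
  moreover have "t \<otimes> (inv x \<otimes> t) = inv x \<otimes> (t \<otimes> t)"
    using central[of t] inv_commute_iff[of x t] m_assoc[of t "inv x" t] m_assoc[of "inv x" t t]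
    by simp
  ultimately have "inv x \<otimes> inv x \<otimes> (t \<otimes> t) = t \<otimes> t" by (simp add: m_assoc)
  then have "inv x \<otimes> inv x = \<one>" by (metis assms(1,2) inv_closed m_closed r_cancel_one)
  then show False using f(4) by (metis assms(1) inv_closed inv_inv eq_inv_iff_square)
qed simp

text \<open>A non-central \<open>x\<close> provides its own non-commuting partner; a central one
  borrows a non-commuting pair from the rest of the group.\<close>

lemma pins_fourth_power:
  assumes [simp]: "x \<in> carrier G" and x4: "x \<otimes> x \<otimes> (x \<otimes> x) \<noteq> \<one>" and "\<not> comm_group G"
  obtains ws where "length ws \<le> 7" "set ws \<subseteq> carrier G" "x \<in> set ws" "pins (set ws) x"
proof (cases "\<exists>y \<in> carrier G. x \<otimes> y \<noteq> y \<otimes> x")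
  case True
  then obtain y where y: "y \<in> carrier G" "x \<otimes> y \<noteq> y \<otimes> x" by blast
  obtain ws where "length ws \<le> 5" "set ws \<subseteq> carrier G" "{x, y, inv x \<otimes> y} \<subseteq> set ws"
    "pins (set ws) x"
    by (rule pins_noncentral[OF assms(1) y x4])
  then show ?thesis by (intro that[of ws]) auto
next
  case False
  obtain t u where tu: "t \<in> carrier G" "u \<in> carrier G" "t \<otimes> u \<noteq> u \<otimes> t"
    using assms(3) group_comm_groupI by blast
  show ?thesis
    by (rule that[of "[x, t, u, inv x \<otimes> t, inv x \<otimes> u, inv t \<otimes> u, inv (inv x \<otimes> t) \<otimes> u]"])
      (use tu False pins_central[of x t u] in auto)
qed

lemma ord_eq_4_iff:
  assumes [simp]: "x \<in> carrier G"
  shows "ord x = 4 \<longleftrightarrow> x \<otimes> x \<otimes> (x \<otimes> x) = \<one> \<and> x \<otimes> x \<noteq> \<one>"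
proof -
  have 4: "x \<otimes> x \<otimes> (x \<otimes> x) = x [^] (4::nat)" and 2: "x \<otimes> x = x [^] (2::nat)"
    by (simp_all add: numeral_eq_Suc m_assoc)
  have "d = 4 \<longleftrightarrow> d dvd 4 \<and> \<not> d dvd 2" for d :: nat
  proof (cases "d \<le> 4")
    case True
    then have "d \<in> {0, 1, 2, 3, 4}" by auto
    then show ?thesis by auto
  next
    case False
    then show ?thesis using dvd_imp_le[of d 4] by auto
  qed
  moreover have "x \<otimes> x \<otimes> (x \<otimes> x) = \<one> \<longleftrightarrow> ord x dvd 4" by (simp only: 4 pow_eq_id[OF assms])
  moreover have "x \<otimes> x = \<one> \<longleftrightarrow> ord x dvd 2" by (simp only: 2 pow_eq_id[OF assms])
  ultimately show ?thesis by metis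
qed

text \<open>The abelian subgroup is the centralizer of \<open>h\<close>: being inverted by
  \<open>x\<close> makes it abelian, and h^2 being non-trivial keeps \<open>x\<close> outside. By
  \<open>nC\<close>, left multiplication by \<open>x\<close> moves every outside element into it, so
  its index is two.\<close>

lemma generalized_dicyclic_centralizer:
  assumes [simp]: "x \<in> carrier G" "h \<in> carrier G"
    and ord: "ord x = 4" and h2: "h \<otimes> h \<noteq> \<one>" and xh: "inverts x h" and "\<not> comm_group G"
    and C: "\<And>g. g \<in> carrier G \<Longrightarrow> g \<otimes> h = h \<otimes> g \<Longrightarrow> inverts x g"
    and nC: "\<And>g. g \<in> carrier G \<Longrightarrow> g \<otimes> h \<noteq> h \<otimes> g \<Longrightarrow> x \<otimes> g \<otimes> h = h \<otimes> (x \<otimes> g)"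
  shows "generalized_dicyclic G"
proof -
  define A where "A = {g \<in> carrier G. g \<otimes> h = h \<otimes> g}"
  have Ac: "g \<in> carrier G" if "g \<in> A" for g using that by (simp add: A_def)
  have sub: "subgroup A G"
  proof (rule subgroupI)
    show "a \<otimes> b \<in> A" if "a \<in> A" "b \<in> A" for a b
    proof -
      have ab: "a \<in> carrier G" "b \<in> carrier G" "a \<otimes> h = h \<otimes> a" "b \<otimes> h = h \<otimes> b"
        using that by (simp_all add: A_def)
      have "a \<otimes> b \<otimes> h = a \<otimes> h \<otimes> b" using ab(1,2,4) by (simp add: m_assoc)
      also have "\<dots> = h \<otimes> (a \<otimes> b)" unfolding ab(3) using ab(1,2) by (simp add: m_assoc)
      finally show ?thesis using ab(1,2) by (simp add: A_def)
    qed
  qed (auto simp: A_def inv_commute_iff)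
  have inv_A: "inverts x a" if "a \<in> A" for a using C that by (simp add: A_def)
  have comm: "a \<otimes> b = b \<otimes> a" if "a \<in> A" "b \<in> A" for a b
    using inverts_products_commute[OF assms(1) Ac[OF that(1)] Ac[OF that(2)]]
      inv_A that subgroup.m_closed[OF sub that] by blast
  have x2: "x \<otimes> x \<in> A" using xh inverts_square_commutes[of x h] by (simp add: A_def)
  have xA: "x \<notin> A" using inverts_commuting[OF _ _ xh] h2 by (auto simp: A_def)
  have conj: "x \<otimes> a = inv a \<otimes> x" if "a \<in> A" for a
    using inv_A[OF that] by (simp add: inverts_def)
  have inA: "inv a \<in> A" if "a \<in> A" for a using sub that by (rule subgroup.m_inv_closed)
  have cases: "x \<otimes> g \<in> A" if "g \<in> carrier G" "g \<notin> A" for g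
    using nC[of g] that by (simp add: A_def)
  note [simp] = Ac
  have coset: "g \<in> A #> x" if g: "g \<in> carrier G" "g \<notin> A" for g
  proof -
    define a where "a = x \<otimes> g"
    have a: "a \<in> A" using cases[OF g] by (simp add: a_def)
    have "g = inv x \<otimes> a" using g by (simp add: a_def inv_mult_cancel)
    \<comment> \<open>Here x^2 lies in \<open>A\<close>; trading \<open>inv x\<close> for
      \<open>x\<close> in this way allows \<open>x\<close> to be moved to the right past
      \<open>a\<close>.\<close>
    also have "\<dots> = inv (x \<otimes> x) \<otimes> (x \<otimes> a)" using a by (simp add: group_word_simps)
    also have "\<dots> = inv (x \<otimes> x) \<otimes> inv a \<otimes> x" using a conj[OF a] x2 by (simp add: m_assoc)
    finally show ?thesis
      using subgroup.m_closed[OF sub inA[OF x2] inA[OF a]] unfolding r_coset_def by blast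
  qed
  have "rcosets A = {A, A #> x}"
  proof (intro equalityI subsetI)
    fix B assume "B \<in> rcosets A"
    then obtain g where g: "g \<in> carrier G" "B = A #> g" by (auto simp: RCOSETS_def)
    then show "B \<in> {A, A #> x}"
      using coset_join2[OF g(1) sub] repr_independence[OF coset[OF g(1)] _ sub] by fastforce
  next
    fix B assume "B \<in> {A, A #> x}"
    then show "B \<in> rcosets A"
      using coset_join2[OF one_closed sub] subgroup.one_closed[OF sub]
      by (auto simp: RCOSETS_def)
  qed
  moreover have "x \<in> A #> x" using rcos_self[OF _ sub] by simp
  ultimately have card: "card (rcosets A) = 2" using xA by (metis card_2_iff)
  have inv_conj: "inv x \<otimes> a \<otimes> x = inv a" if "a \<in> A" for a
  proof -
    have "inv x \<otimes> a \<otimes> x = inv x \<otimes> (x \<otimes> inv a)"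
      using conj[OF inA[OF that]] that by (simp add: m_assoc)
    then show ?thesis using that by (simp add: inv_mult_cancel)
  qed
  have normal: "A \<lhd> G"
    unfolding normal_inv_iff
  proof (intro conjI sub ballI)
    fix g a assume g: "g \<in> carrier G" and a: "a \<in> A"
    show "g \<otimes> a \<otimes> inv g \<in> A"
    proof (cases "g \<in> A")
      case True
      then show ?thesis using a inA subgroup.m_closed[OF sub] by blast
    next
      case False
      \<comment> \<open>For \<open>g\<close> outside \<open>A\<close>, the element
        \<open>x \<otimes> g\<close> lies in \<open>A\<close> and commutes with \<open>a\<close>, so
        conjugation by \<open>g\<close> acts like conjugation by \<open>inv x\<close>.\<close>
      have "g \<otimes> a \<otimes> inv g = inv x \<otimes> (x \<otimes> g \<otimes> a) \<otimes> inv g"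
        using g a by (simp add: group_word_simps)
      also have "\<dots> = inv x \<otimes> a \<otimes> x"
        unfolding comm[OF cases[OF g False] a] using g a by (simp add: group_word_simps)
      finally show ?thesis using inv_conj[OF a] inA[OF a] by simp
    qed
  qed
  have "comm_group (G\<lparr>carrier := A\<rparr>)"
    using subgroup_imp_group[OF sub] comm by (intro group.group_comm_groupI) auto
  then have "abelian_subgroup G A" using sub by (simp add: abelian_subgroup_def)
  moreover have "x \<otimes> a \<otimes> inv x = inv a" if "a \<in> A" for a
    using conj[OF that] that by (simp add: m_assoc)
  ultimately show ?thesis
    using assms(6) normal card xA ord is_group unfolding generalized_dicyclic_def
    by (metis DiffI assms(1))
qed

text \<open>The delicate case is an \<open>x\<close> of order 4 that inverts \<open>h\<close>: if
  x^2 = 1 there is nothing to flip, a non-trivial fourth power is covered by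
  \<open>pins_fourth_power\<close>, and if \<open>x\<close> does not invert \<open>h\<close> then
  the word \<open>inv x \<otimes> h\<close> prevents a flip.\<close>

lemma pins_any:
  assumes h [simp]: "h \<in> carrier G" and ph: "pins U h" and U: "U \<subseteq> carrier G"
    and h2: "h \<otimes> h \<noteq> \<one>" and gd: "\<not> generalized_dicyclic G" and nc: "\<not> comm_group G"
    and x [simp]: "x \<in> carrier G"
  obtains ws where "length ws \<le> 7" "set ws \<subseteq> carrier G" "x \<in> set ws" "pins (U \<union> set ws) x"
proof -
  note result = that
  have *: thesis
    if ws: "set ws \<subseteq> carrier G" "length ws \<le> 7" "x \<in> set ws"
    and no: "\<And>\<phi>. normalised_colour_map G (U \<union> set ws) \<phi> \<Longrightarrow> \<phi> h = h \<Longrightarrow>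
      (\<And>g. g \<in> carrier G \<Longrightarrow> \<phi> (g \<otimes> h) = \<phi> g \<otimes> h) \<Longrightarrow>
      \<phi> x = inv x \<Longrightarrow> x \<noteq> inv x \<Longrightarrow> False" for ws
  proof (rule result[OF ws(2,1,3)], rule pinsI)
    show W: "U \<union> set ws \<subseteq> carrier G" using U ws by blast
    have p: "pins (U \<union> set ws) h" by (rule pins_mono[OF ph]) simp
    fix \<phi> assume f: "\<phi> \<in> colour_maps (U \<union> set ws)" "\<phi> \<one> = \<one>" "\<phi> x = inv x" "x \<noteq> inv x"
    show False
    proof (rule no[of \<phi>])
      show "normalised_colour_map G (U \<union> set ws) \<phi>" by unfold_locales (use f W in auto)
      show "\<phi> h = h" using p f by (simp add: pins_def)
      show "\<phi> (g \<otimes> h) = \<phi> g \<otimes> h" if "g \<in> carrier G" for g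
        by (rule pinsD[OF p f(1) that h W])
    qed (use f in auto)
  qed (use ws in simp)
  show thesis
  proof (cases "x \<otimes> x = \<one>")
    case True
    then show thesis by (intro *[of "[x]"]) (auto simp: eq_inv_iff_square)
  next
    case x2: False
    show thesis
    proof (cases "x \<otimes> x \<otimes> (x \<otimes> x) = \<one>")
      case False
      then obtain ws where "length ws \<le> 7" "set ws \<subseteq> carrier G" "x \<in> set ws" "pins (set ws) x"
        using pins_fourth_power[OF x _ nc] by blast
      then show thesis using that pins_mono by blast
    next
      case x4: True
      show thesis
      proof (cases "inverts x h")
        case False
        show thesis
        proof (rule *[of "[x, inv x \<otimes> h]"])
          fix \<phi> assume "normalised_colour_map G (U \<union> set [x, inv x \<otimes> h]) \<phi>"
            and f: "\<phi> h = h" "\<phi> x = inv x" "x \<noteq> inv x"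
          then interpret normalised_colour_map G "U \<union> set [x, inv x \<otimes> h]" \<phi> by simp
          show False using fixed_inverted[OF x h f(2,3,1)] False by simp
        qed auto
      next
        case xh: True
        \<comment> \<open>Now only \<open>C\<close> or \<open>nC\<close> of
          \<open>generalized_dicyclic_centralizer\<close> can fail, and a counterexample
          \<open>g\<close> to either one supplies the words.\<close>
        consider g where "g \<in> carrier G" "g \<otimes> h = h \<otimes> g" "\<not> inverts x g"
          | g where "g \<in> carrier G" "g \<otimes> h \<noteq> h \<otimes> g" "x \<otimes> g \<otimes> h \<noteq> h \<otimes> (x \<otimes> g)"
          using generalized_dicyclic_centralizer[OF x h _ h2 xh nc] gd x2 x4 ord_eq_4_iff[OF x]
          by blast
        then show thesis
        proof cases
          case 1
          note g [simp] = 1(1)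
          let ?ws = "[x, g, inv g \<otimes> h, inv x \<otimes> g]"
          show thesis
          proof (rule *[of ?ws])
            fix \<phi> assume "normalised_colour_map G (U \<union> set ?ws) \<phi>"
              and f: "\<phi> h = h" "\<phi> x = inv x" "x \<noteq> inv x"
            then interpret normalised_colour_map G "U \<union> set ?ws" \<phi> by simp
            have "\<phi> g \<noteq> g" using fixed_inverted[OF x g f(2,3)] 1(3) by auto
            then have "\<phi> g = inv g" "g \<noteq> inv g" using \<phi>_cases[of g] by auto
            then have "inverts g h" using fixed_inverted[OF g h _ _ f(1)] by auto
            then show False using inverts_commuting[OF g h] 1(2) h2 by simp
          qed auto
        next
          case 2
          note g [simp] = 2(1)
          let ?ws = "[x, inv x \<otimes> h, g, inv g \<otimes> h, inv x \<otimes> g, inv x \<otimes> (g \<otimes> h)]"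
          show thesis
          proof (rule *[of ?ws])
            fix \<phi> assume "normalised_colour_map G (U \<union> set ?ws) \<phi>"
              and f: "\<phi> h = h" "\<phi> x = inv x" "x \<noteq> inv x"
              and m: "\<And>g. g \<in> carrier G \<Longrightarrow> \<phi> (g \<otimes> h) = \<phi> g \<otimes> h"
            then interpret normalised_colour_map G "U \<union> set ?ws" \<phi> by simp
            show False
            proof (cases "\<phi> g = g")
              case True
              have "inverts x g" using fixed_inverted[OF x g f(2,3) True] by simp
              \<comment> \<open>As \<open>h\<close> is pinned at every vertex, fixing
                \<open>g\<close> also fixes \<open>g \<otimes> h\<close>.\<close>
              moreover have "inverts x (g \<otimes> h)"
                using fixed_inverted[OF x _ f(2,3), of "g \<otimes> h"] m[OF g] True by simp
              ultimately show False using inverts_products_commute[of x g h] xh 2(2) by simp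
            next
              case False
              then have "\<phi> g = inv g" "g \<noteq> inv g" using \<phi>_cases[of g] by auto
              then have gh: "g \<otimes> h = inv h \<otimes> g"
                using fixed_inverted[OF g h _ _ f(1)] by (auto simp: inverts_def)
              have "x \<otimes> g \<otimes> h = x \<otimes> inv h \<otimes> g" by (simp add: m_assoc gh)
              also have "\<dots> = h \<otimes> (x \<otimes> g)"
                using inverts_inv[OF x h xh] by (simp add: inverts_def m_assoc)
              finally show False using 2(3) by simp
            qed
          qed auto
        qed
      qed
    qed
  qed
qed

lemma pins_collect:
  assumes "finite S"
    and "\<And>x. x \<in> S \<Longrightarrow> \<exists>ws. length ws \<le> k \<and> set ws \<subseteq> carrier G \<and> x \<in> set ws \<and> pins (U \<union> set ws) x"
  obtains ws where "length ws \<le> k * card S" "set ws \<subseteq> carrier G" "S \<subseteq> set ws"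
    "\<And>x. x \<in> S \<Longrightarrow> pins (U \<union> set ws) x"
  using assms
proof (induction S arbitrary: thesis rule: finite_induct)
  case empty
  then show ?case by (metis card.empty empty_iff empty_set empty_subsetI le0 list.size(3))
next
  case (insert y S)
  obtain ws where ws: "length ws \<le> k * card S" "set ws \<subseteq> carrier G" "S \<subseteq> set ws"
    "\<And>x. x \<in> S \<Longrightarrow> pins (U \<union> set ws) x"
    using insert.IH insert.prems(2) by (metis insertCI)
  obtain vs where vs: "length vs \<le> k" "set vs \<subseteq> carrier G" "y \<in> set vs" "pins (U \<union> set vs) y"
    using insert.prems(2) by blast
  show ?case
  proof (rule insert.prems(1)[of "vs @ ws"])
    show "length (vs @ ws) \<le> k * card (insert y S)" using ws(1) vs(1) insert.hyps by simp
    fix x assume "x \<in> insert y S"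
    then show "pins (U \<union> set (vs @ ws)) x"
    proof
      assume "x \<in> S"
      then show ?thesis by (intro pins_mono[OF ws(4)]) auto
    qed (auto intro: pins_mono[OF vs(4)])
  qed (use ws vs in auto)
qed

text \<open>Seven words pin \<open>h\<close> once and for all; this common stock is shared by all
  generators, each of which adds at most seven words of its own.\<close>

lemma pins_generators:
  assumes "finite S" "S \<subseteq> carrier G" "\<not> generalized_dicyclic G" and nc: "\<not> comm_group G"
    and h: "h \<in> carrier G" and h4: "h \<otimes> h \<otimes> (h \<otimes> h) \<noteq> \<one>"
  obtains ws where "length ws \<le> 7 * (card S + 1)" "set ws \<subseteq> carrier G" "S \<subseteq> set ws"
    "\<And>x. x \<in> S \<Longrightarrow> pins (set ws) x"
proof -
  obtain us where us: "length us \<le> 7" "set us \<subseteq> carrier G" "pins (set us) h"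
    using pins_fourth_power[OF h h4 nc] by metis
  have h2: "h \<otimes> h \<noteq> \<one>" using h4 by auto
  obtain ws where "length ws \<le> 7 * card S" "set ws \<subseteq> carrier G" "S \<subseteq> set ws"
    "\<And>x. x \<in> S \<Longrightarrow> pins (set us \<union> set ws) x"
  proof (rule pins_collect[OF assms(1), of 7 "set us"])
    fix x assume "x \<in> S"
    then have "x \<in> carrier G" using assms(2) by blast
    then show "\<exists>ws. length ws \<le> 7 \<and> set ws \<subseteq> carrier G \<and> x \<in> set ws \<and> pins (set us \<union> set ws) x"
      using pins_any[OF h us(3,2) h2 assms(3) nc] by metis
  qed blast
  then show ?thesis using us by (intro that[of "us @ ws"]) auto
qed

section \<open>Fewer words under the hypotheses of (2)\<close>

lemma mult_swap:
  assumes "y \<otimes> h = l \<otimes> y" "x \<otimes> l = k \<otimes> x"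
    and [simp]: "x \<in> carrier G" "y \<in> carrier G" "h \<in> carrier G" "k \<in> carrier G" "l \<in> carrier G"
  shows "x \<otimes> y \<otimes> h = k \<otimes> (x \<otimes> y)"
proof -
  have "x \<otimes> y \<otimes> h = x \<otimes> l \<otimes> y" by (simp add: m_assoc assms(1))
  then show ?thesis by (simp add: assms(2)) (simp add: m_assoc)
qed

lemma generate_commutes:
  assumes "A \<subseteq> carrier G" "b \<in> carrier G" "\<And>a. a \<in> A \<Longrightarrow> a \<otimes> b = b \<otimes> a"
    and "x \<in> generate G A"
  shows "x \<otimes> b = b \<otimes> x"
  using assms(4)
proof induction
  case (inv a)
  then show ?case using assms inv_commute_iff[of a b] by blast
next
  case (eng x y)
  then have c: "x \<in> carrier G" "y \<in> carrier G" using generate_incl[OF assms(1)] by auto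
  then show ?case using eng.IH assms(2) by (intro mult_swap)
qed (use assms in auto)

lemma generate_commutative:
  assumes "A \<subseteq> carrier G" "\<And>a b. a \<in> A \<Longrightarrow> b \<in> A \<Longrightarrow> a \<otimes> b = b \<otimes> a"
    and "x \<in> generate G A" "y \<in> generate G A"
  shows "x \<otimes> y = y \<otimes> x"
proof (rule generate_commutes[OF assms(1) _ _ assms(3)])
  show "y \<in> carrier G" using generate_incl[OF assms(1)] assms(4) by blast
  fix a assume "a \<in> A"
  then show "a \<otimes> y = y \<otimes> a"
    using generate_commutes[OF assms(1) _ _ assms(4), of a] assms(1,2) by auto
qed

lemma noncommuting_generators:
  assumes "S \<subseteq> carrier G" "generate G S = carrier G" "\<not> comm_group G"
  obtains t u where "t \<in> S" "u \<in> S" "t \<otimes> u \<noteq> u \<otimes> t"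
proof -
  have "\<not> (\<forall>a \<in> carrier G. \<forall>b \<in> carrier G. a \<otimes> b = b \<otimes> a)"
    using group_comm_groupI assms(3) by blast
  then have "\<not> (\<forall>t \<in> S. \<forall>u \<in> S. t \<otimes> u = u \<otimes> t)"
    using generate_commutative[OF assms(1)] assms(2) by blast
  then show ?thesis using that by blast
qed

text \<open>The elements with non-trivial fourth power generate a characteristic subgroup.\<close>

lemma noncommuting_fourth_powers:
  assumes nca: "\<And>H. characteristic_subgroup G H \<Longrightarrow> abelian_subgroup G H \<Longrightarrow> H = {\<one>}"
    and h: "h \<in> carrier G" "h \<otimes> h \<otimes> (h \<otimes> h) \<noteq> \<one>"
  obtains t u where "t \<in> carrier G" "u \<in> carrier G" "t \<otimes> t \<otimes> (t \<otimes> t) \<noteq> \<one>"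
    "u \<otimes> u \<otimes> (u \<otimes> u) \<noteq> \<one>" "t \<otimes> u \<noteq> u \<otimes> t"
proof -
  define K where "K = {g \<in> carrier G. g \<otimes> g \<otimes> (g \<otimes> g) \<noteq> \<one>}"
  have K: "K \<subseteq> carrier G" by (auto simp: K_def)
  have sub: "subgroup (generate G K) G" by (rule generate_is_subgroup[OF K])
  have "\<phi> ` generate G K = generate G K" if \<phi>: "\<phi> \<in> iso G G" for \<phi>
  proof -
    interpret \<phi>: group_hom G G \<phi>
      by (simp add: group_hom_def group_hom_axioms_def is_group \<phi> iso_imp_homomorphism)
    have surj: "\<phi> ` carrier G = carrier G" and inj: "inj_on \<phi> (carrier G)"
      using \<phi> by (auto simp: iso_def bij_betw_def)
    have inv: "\<phi> g \<in> K \<longleftrightarrow> g \<in> K" if g: "g \<in> carrier G" for g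
    proof -
      have "\<phi> (g \<otimes> g \<otimes> (g \<otimes> g)) = \<phi> \<one> \<longleftrightarrow> g \<otimes> g \<otimes> (g \<otimes> g) = \<one>"
        using g by (intro inj_on_eq_iff[OF inj]) simp_all
      then show ?thesis using g by (simp add: K_def)
    qed
    have "\<phi> ` K = K"
    proof
      show "\<phi> ` K \<subseteq> K" using inv K by blast
      show "K \<subseteq> \<phi> ` K"
      proof
        fix k assume k: "k \<in> K"
        then obtain g where "g \<in> carrier G" "k = \<phi> g" using K surj by blast
        then show "k \<in> \<phi> ` K" using inv k by blast
      qed
    qed
    then show ?thesis using \<phi>.generate_img[OF K] by simp
  qed
  then have "characteristic_subgroup G (generate G K)"
    using sub by (simp add: characteristic_subgroup_def)
  moreover have "h \<in> generate G K" using h by (intro generate.incl) (simp add: K_def)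
  moreover have "h \<noteq> \<one>" using h by auto
  ultimately have "\<not> abelian_subgroup G (generate G K)" using nca by blast
  then have "\<not> comm_group (G\<lparr>carrier := generate G K\<rparr>)"
    using sub by (simp add: abelian_subgroup_def)
  moreover have "group (G\<lparr>carrier := generate G K\<rparr>)" by (rule subgroup_imp_group[OF sub])
  ultimately have "\<not> (\<forall>a \<in> generate G K. \<forall>b \<in> generate G K. a \<otimes> b = b \<otimes> a)"
    using group.group_comm_groupI[of "G\<lparr>carrier := generate G K\<rparr>"] by auto
  then have "\<not> (\<forall>t \<in> K. \<forall>u \<in> K. t \<otimes> u = u \<otimes> t)"
    using generate_commutative[OF K] by blast
  then obtain t u where "t \<in> K" "u \<in> K" "t \<otimes> u \<noteq> u \<otimes> t" by blast
  then show ?thesis by (intro that[of t u]) (auto simp: K_def)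
qed

text \<open>A flipped \<open>u\<close> next to a fixed \<open>t\<close> would invert
  \<open>t\<close>, as in \<open>fixed_inverted\<close>. The edge is read from \<open>t\<close> to
  \<open>u\<close>, because \<open>inv t \<otimes> u\<close> is the word that
  \<open>pins_noncentral\<close> already supplies.\<close>

lemma pins_step:
  assumes [simp]: "t \<in> carrier G" "u \<in> carrier G"
    and "pins W t" "u \<in> W" "inv t \<otimes> u \<in> W" and W: "W \<subseteq> carrier G" and n: "\<not> inverts u t"
  shows "pins W u"
proof (rule pinsI[OF assms(4) _ W])
  fix \<phi> assume f: "\<phi> \<in> colour_maps W" "\<phi> \<one> = \<one>" "\<phi> u = inv u" "u \<noteq> inv u"
  interpret normalised_colour_map G W \<phi> by unfold_locales (use f W in auto)
  have "\<phi> t = t" using assms(3) f by (simp add: pins_def)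
  then have "inv t \<otimes> inv u = inv t \<otimes> u \<or> inv t \<otimes> inv u = inv u \<otimes> t"
    using edge[of t u] f(3) assms(5) by simp
  then show False
  proof
    assume "inv t \<otimes> inv u = inv t \<otimes> u"
    then show False using f(4) by simp
  next
    assume "inv t \<otimes> inv u = inv u \<otimes> t"
    then have "inv (inv t \<otimes> inv u) = inv (inv u \<otimes> t)" by simp
    then have "u \<otimes> t = inv t \<otimes> u" by (simp add: inv_mult_group)
    then show False using n by (simp add: inverts_def)
  qed
qed

text \<open>An involution is pinned by its own colour, and inverting it means commuting with it, so
  \<open>pins_step\<close> applies. If neither element is an involution, both have non-trivial
  fourth power and \<open>mutually_inverting\<close> shows that one of them is not inverted by the
  other; that one is pinned first.\<close>

lemma pins_pair:
  assumes c: "t \<in> carrier G" "u \<in> carrier G" and tu: "t \<otimes> u \<noteq> u \<otimes> t"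
    and "t \<otimes> t = \<one> \<or> t \<otimes> t \<otimes> (t \<otimes> t) \<noteq> \<one>" "u \<otimes> u = \<one> \<or> u \<otimes> u \<otimes> (u \<otimes> u) \<noteq> \<one>"
  obtains us where "length us \<le> 5" "set us \<subseteq> carrier G" "{t, u} \<subseteq> set us"
    "pins (set us) t" "pins (set us) u"
proof -
  have involution: "\<exists>us. length us \<le> 5 \<and> set us \<subseteq> carrier G \<and> {t, u} \<subseteq> set us \<and>
      pins (set us) t \<and> pins (set us) u"
    if [simp]: "t \<in> carrier G" "u \<in> carrier G" and tu: "t \<otimes> u \<noteq> u \<otimes> t" and t2: "t \<otimes> t = \<one>" for t u
  proof -
    have p: "pins (set [t, u, inv t \<otimes> u]) t" using t2 by (intro pins_involution) auto
    have "t = inv t" using t2 by (simp add: eq_inv_iff_square)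
    then have "\<not> inverts u t" using tu by (simp add: inverts_def)
    then have "pins (set [t, u, inv t \<otimes> u]) u" by (intro pins_step[OF _ _ p]) auto
    with p show ?thesis by (intro exI[of _ "[t, u, inv t \<otimes> u]"]) simp
  qed
  have fourth: "\<exists>us. length us \<le> 5 \<and> set us \<subseteq> carrier G \<and> {t, u} \<subseteq> set us \<and>
      pins (set us) t \<and> pins (set us) u"
    if c: "t \<in> carrier G" "u \<in> carrier G" and tu: "t \<otimes> u \<noteq> u \<otimes> t"
      and t4: "t \<otimes> t \<otimes> (t \<otimes> t) \<noteq> \<one>" and n: "\<not> inverts u t" for t u
  proof -
    obtain us where us: "length us \<le> 5" "set us \<subseteq> carrier G" "{t, u, inv t \<otimes> u} \<subseteq> set us"
      "pins (set us) t"
      by (rule pins_noncentral[OF c tu t4])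
    then have "pins (set us) u" by (intro pins_step[OF c us(4) _ _ us(2) n]) auto
    with us show ?thesis by blast
  qed
  show ?thesis
  proof (cases "t \<otimes> t = \<one> \<or> u \<otimes> u = \<one>")
    case True
    then show ?thesis using involution[OF c tu] involution[OF c(2,1) tu[symmetric]] that by blast
  next
    case False
    then have 4: "t \<otimes> t \<otimes> (t \<otimes> t) \<noteq> \<one>" "u \<otimes> u \<otimes> (u \<otimes> u) \<noteq> \<one>" using assms(4,5) by auto
    then have "\<not> inverts u t \<or> \<not> inverts t u" using mutually_inverting[OF c] by blast
    then show ?thesis
      using fourth[OF c tu 4(1)] fourth[OF c(2,1) tu[symmetric] 4(2)] that by blast
  qed
qed

text \<open>The elements that conjugate \<open>h\<close> to \<open>h\<close> or \<open>inv h\<close>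
  form a subgroup, so it suffices to test generators.\<close>

lemma commutes_or_inverts_generate:
  assumes S: "S \<subseteq> carrier G" and h [simp]: "h \<in> carrier G"
    and "\<And>x. x \<in> S \<Longrightarrow> x \<otimes> h = h \<otimes> x \<or> inverts x h" and "g \<in> generate G S"
  shows "g \<otimes> h = h \<otimes> g \<or> inverts g h"
  using assms(4)
proof induction
  case (inv x)
  then show ?case using assms(3)[of x] S inv_commute_iff[of x h] inverts_inv_left[of x h] by auto
next
  case (eng x y)
  then have c [simp]: "x \<in> carrier G" "y \<in> carrier G" using generate_incl[OF S] by auto
  have swap: "x \<otimes> y \<otimes> h = k \<otimes> (x \<otimes> y)"
    if "y \<otimes> h = l \<otimes> y" "x \<otimes> l = k \<otimes> x" "k \<in> carrier G" "l \<in> carrier G" for k l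
    by (rule mult_swap[OF that(1,2) c h that(3,4)])
  have hx: "x \<otimes> inv h = inv h \<otimes> x" if "x \<otimes> h = h \<otimes> x"
    using that inv_commute_iff[of h x] by simp
  have ix: "x \<otimes> inv h = h \<otimes> x" if "inverts x h"
    using inverts_inv[OF c(1) h that] by (simp add: inverts_def)
  from eng.IH(2) show ?case
  proof
    assume y: "y \<otimes> h = h \<otimes> y"
    show ?thesis
      using eng.IH(1) swap[OF y _ h h] swap[OF y _ inv_closed[OF h] h] unfolding inverts_def by blast
  next
    assume "inverts y h"
    then have y: "y \<otimes> h = inv h \<otimes> y" by (simp add: inverts_def)
    show ?thesis
      using eng.IH(1) swap[OF y hx inv_closed[OF h] inv_closed[OF h]]
        swap[OF y ix h inv_closed[OF h]] unfolding inverts_def by blast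
  qed
qed (use assms in auto)

text \<open>Without elements of order 4, every element is trivial or an involution or has
  non-trivial fourth power, so \<open>pins_pair\<close> applies to two non-commuting generators.
  Otherwise the seed consists of an element \<open>k\<close> with non-trivial fourth power and a
  generator that neither commutes with it nor inverts it.\<close>

lemma pins_seed:
  assumes S: "S \<subseteq> carrier G" "generate G S = carrier G" and nc: "\<not> comm_group G"
    and hyp: "no_order_4_or_no_char_abelian G"
    and h: "h \<in> carrier G" "h \<otimes> h \<otimes> (h \<otimes> h) \<noteq> \<one>"
  obtains us x p where "length us \<le> 5" "set us \<subseteq> carrier G" "x \<in> S" "x \<in> set us" "p \<in> carrier G"
    "x \<otimes> p \<noteq> p \<otimes> x" "pins (set us) x" "pins (set us) p"
proof (cases "\<exists>x \<in> carrier G. ord x = 4")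
  case False
  obtain t u where tu: "t \<in> S" "u \<in> S" "t \<otimes> u \<noteq> u \<otimes> t"
    by (rule noncommuting_generators[OF S nc])
  then have c: "t \<in> carrier G" "u \<in> carrier G" using S by auto
  have sq: "x \<otimes> x = \<one> \<or> x \<otimes> x \<otimes> (x \<otimes> x) \<noteq> \<one>" if "x \<in> carrier G" for x
    using False ord_eq_4_iff that by blast
  obtain us where "length us \<le> 5" "set us \<subseteq> carrier G" "{t, u} \<subseteq> set us"
    "pins (set us) t" "pins (set us) u"
    by (rule pins_pair[OF c tu(3) sq[OF c(1)] sq[OF c(2)]])
  then show ?thesis using tu c by (intro that[of us t u]) auto
next
  case True
  then have nca: "H = {\<one>}" if "characteristic_subgroup G H" "abelian_subgroup G H" for H
    using hyp that unfolding no_order_4_or_no_char_abelian_def by blast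
  obtain t u where tu: "t \<in> carrier G" "u \<in> carrier G" "t \<otimes> t \<otimes> (t \<otimes> t) \<noteq> \<one>"
    "u \<otimes> u \<otimes> (u \<otimes> u) \<noteq> \<one>" "t \<otimes> u \<noteq> u \<otimes> t"
    by (rule noncommuting_fourth_powers[OF nca h])
  \<comment> \<open>If there were no such pair, then by \<open>commutes_or_inverts_generate\<close>
    every group element would commute with or invert every such \<open>k\<close>; the non-commuting
    \<open>t\<close> and \<open>u\<close> would invert each other, against their non-trivial fourth
    powers.\<close>
  have "\<exists>k x. k \<in> carrier G \<and> k \<otimes> k \<otimes> (k \<otimes> k) \<noteq> \<one> \<and> x \<in> S \<and> k \<otimes> x \<noteq> x \<otimes> k \<and> \<not> inverts x k"
  proof (rule ccontr)
    assume n: "\<not> ?thesis"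
    have *: "g \<otimes> k = k \<otimes> g \<or> inverts g k"
      if "k \<in> carrier G" "k \<otimes> k \<otimes> (k \<otimes> k) \<noteq> \<one>" "g \<in> carrier G" for g k
    proof (rule commutes_or_inverts_generate[OF S(1) that(1)])
      show "g \<in> generate G S" using that(3) S(2) by simp
      fix x assume "x \<in> S"
      then show "x \<otimes> k = k \<otimes> x \<or> inverts x k" using n that(1,2) by force
    qed
    have "inverts t u" "inverts u t"
      using *[OF tu(2,4,1)] *[OF tu(1,3,2)] tu(5) by auto
    then show False using mutually_inverting[OF tu(1,2)] tu(3) by blast
  qed
  then obtain k x where k: "k \<in> carrier G" "k \<otimes> k \<otimes> (k \<otimes> k) \<noteq> \<one>"
    and x: "x \<in> S" "k \<otimes> x \<noteq> x \<otimes> k" "\<not> inverts x k"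
    by blast
  have xc: "x \<in> carrier G" using x S by blast
  obtain us where us: "length us \<le> 5" "set us \<subseteq> carrier G" "{k, x, inv k \<otimes> x} \<subseteq> set us"
    "pins (set us) k"
    by (rule pins_noncentral[OF k(1) xc x(2) k(2)])
  have "pins (set us) x" using us by (intro pins_step[OF k(1) xc us(4) _ _ us(2) x(3)]) auto
  then show ?thesis using us x k by (intro that[of us x k]) auto
qed

text \<open>No \<open>y\<close> inverts all three pinned elements \<open>x\<close>,
  \<open>p\<close>, \<open>x \<otimes> p\<close>, because \<open>x\<close> and \<open>p\<close> do
  not commute. Some pinned \<open>k\<close> is therefore not inverted, and the two words
  \<open>y\<close> and \<open>inv k \<otimes> y\<close> pin \<open>y\<close>. As \<open>x\<close> is
  itself a generator, the count is 5 + 2 (|S| - 1).\<close>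

lemma pins_generators_short:
  assumes fin: "finite S" and S: "S \<subseteq> carrier G" "generate G S = carrier G" and nc: "\<not> comm_group G"
    and hyp: "no_order_4_or_no_char_abelian G"
    and h: "h \<in> carrier G" "h \<otimes> h \<otimes> (h \<otimes> h) \<noteq> \<one>"
  obtains ws where "length ws \<le> 2 * card S + 3" "set ws \<subseteq> carrier G" "S \<subseteq> set ws"
    "\<And>x. x \<in> S \<Longrightarrow> pins (set ws) x"
proof -
  obtain us x p where us: "length us \<le> 5" "set us \<subseteq> carrier G" "x \<in> S" "x \<in> set us" "p \<in> carrier G"
    "x \<otimes> p \<noteq> p \<otimes> x" "pins (set us) x" "pins (set us) p"
    by (rule pins_seed[OF S nc hyp h])
  have x: "x \<in> carrier G" using us S by blast
  have xp: "pins (set us) (x \<otimes> p)" by (rule pins_mult) (use us x in auto)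
  obtain ws where ws: "length ws \<le> 2 * card (S - {x})" "set ws \<subseteq> carrier G" "S - {x} \<subseteq> set ws"
    "\<And>y. y \<in> S - {x} \<Longrightarrow> pins (set us \<union> set ws) y"
  proof (rule pins_collect[of "S - {x}" 2 "set us"])
    fix y assume "y \<in> S - {x}"
    then have y: "y \<in> carrier G" using S by blast
    obtain k where k: "k \<in> {x, p, x \<otimes> p}" "\<not> inverts y k"
      using inverts_products_commute[OF y x us(5)] us(6) by blast
    then have kc: "k \<in> carrier G" and pk: "pins (set us) k" using us x xp by auto
    let ?W = "set us \<union> set [y, inv k \<otimes> y]"
    have "pins ?W y"
      by (rule pins_step[OF kc y pins_mono[OF pk]]) (use us y kc k in auto)
    then show "\<exists>ws. length ws \<le> 2 \<and> set ws \<subseteq> carrier G \<and> y \<in> set ws \<and> pins (set us \<union> set ws) y"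
      using y kc by (intro exI[of _ "[y, inv k \<otimes> y]"]) auto
  qed (use fin in auto)
  have "card S \<ge> 1" using fin us(3) by (metis One_nat_def Suc_leI card_gt_0_iff empty_iff)
  moreover have "card (S - {x}) = card S - 1" using us(3) by simp
  ultimately have "length (us @ ws) \<le> 2 * card S + 3" using us(1) ws(1) by simp
  moreover have "pins (set (us @ ws)) y" if "y \<in> S" for y
    using that ws(4)[of y] pins_mono[OF us(7), of "set (us @ ws)"] by (cases "y = x") auto
  ultimately show ?thesis using us ws by (intro that[of "us @ ws"]) auto
qed

section \<open>Counting triangles\<close>

definition symmetric_subset :: "'a set \<Rightarrow> bool" where
  "symmetric_subset T \<longleftrightarrow> finite T \<and> T \<subseteq> carrier G \<and> \<one> \<notin> T \<and> (\<forall>t \<in> T. inv t \<in> T)"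

text \<open>The number of triangles of the Cayley graph of \<open>T\<close> that contain the edge from \<open>\<one>\<close> to \<open>v\<close>.\<close>

definition triangles :: "'a set \<Rightarrow> 'a \<Rightarrow> nat" where
  "triangles T v = card {x \<in> T. inv x \<otimes> v \<in> T}"

text \<open>Left multiplication by \<open>v\<close> carries the edge from \<open>\<one>\<close> to
  \<open>inv v\<close> to the edge from \<open>v\<close> to \<open>\<one>\<close>.\<close>

lemma triangles_inv:
  assumes T: "symmetric_subset T" and v: "v \<in> carrier G"
  shows "triangles T (inv v) = triangles T v"
proof -
  have Tc: "x \<in> carrier G" "inv x \<in> T" if "x \<in> T" for x
    using T that by (auto simp: symmetric_subset_def)
  have *: "inv (inv x \<otimes> inv v) = v \<otimes> x" if "x \<in> T" for x
    using Tc(1)[OF that] v by (simp add: inv_mult_group)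
  have "bij_betw (\<lambda>x. v \<otimes> x) {x \<in> T. inv x \<otimes> inv v \<in> T} {x \<in> T. inv x \<otimes> v \<in> T}"
  proof (rule bij_betw_byWitness[where f' = "\<lambda>x. inv v \<otimes> x"])
    show "(\<lambda>x. v \<otimes> x) ` {x \<in> T. inv x \<otimes> inv v \<in> T} \<subseteq> {x \<in> T. inv x \<otimes> v \<in> T}"
    proof (intro image_subsetI CollectI conjI)
      fix x assume "x \<in> {x \<in> T. inv x \<otimes> inv v \<in> T}"
      then have x: "x \<in> T" "inv x \<otimes> inv v \<in> T" by auto
      show "v \<otimes> x \<in> T" using Tc(2)[OF x(2)] *[OF x(1)] by simp
      show "inv (v \<otimes> x) \<otimes> v \<in> T" using Tc[OF x(1)] v by (simp add: group_word_simps)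
    qed
    show "(\<lambda>x. inv v \<otimes> x) ` {x \<in> T. inv x \<otimes> v \<in> T} \<subseteq> {x \<in> T. inv x \<otimes> inv v \<in> T}"
    proof (intro image_subsetI CollectI conjI)
      fix x assume "x \<in> {x \<in> T. inv x \<otimes> v \<in> T}"
      then have x: "x \<in> T" "inv x \<otimes> v \<in> T" by auto
      show "inv v \<otimes> x \<in> T" using Tc(2)[OF x(2)] Tc(1)[OF x(1)] v by (simp add: inv_mult_group)
      show "inv (inv v \<otimes> x) \<otimes> inv v \<in> T" using Tc[OF x(1)] v by (simp add: group_word_simps)
    qed
  qed (use Tc v in \<open>auto simp: group_word_simps\<close>)
  then show ?thesis unfolding triangles_def by (rule bij_betw_same_card)
qed

text \<open>The ball of radius two around \<open>\<one>\<close> in the Cayley graph of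
  \<open>T\<close>. An element outside it is new and is not the third side of a triangle with two
  sides in \<open>T\<close>.\<close>

definition short_products :: "'a set \<Rightarrow> 'a set" where
  "short_products T = (\<lambda>p. fst p \<otimes> snd p) ` (insert \<one> T \<times> insert \<one> T)"

lemma short_products:
  assumes "symmetric_subset T"
  shows "\<one> \<in> short_products T" "T \<subseteq> short_products T"
    "x \<in> T \<Longrightarrow> y \<in> T \<Longrightarrow> x \<otimes> y \<in> short_products T"
    "x \<in> short_products T \<Longrightarrow> inv x \<in> short_products T"
    "short_products T \<subseteq> carrier G" "finite (short_products T)"
    "card (short_products T) \<le> (card T + 1)\<^sup>2"
proof -
  have T: "finite T" "T \<subseteq> carrier G" "\<And>t. t \<in> T \<Longrightarrow> inv t \<in> T"
    using assms by (auto simp: symmetric_subset_def)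
  have I: "x \<otimes> y \<in> short_products T" if "x \<in> insert \<one> T" "y \<in> insert \<one> T" for x y
    using that unfolding short_products_def by force
  show "\<one> \<in> short_products T" using I[of \<one> \<one>] by simp
  show "T \<subseteq> short_products T" using I[of \<one>] T(2) by (metis insertCI l_one subset_iff)
  show "x \<in> T \<Longrightarrow> y \<in> T \<Longrightarrow> x \<otimes> y \<in> short_products T" using I by simp
  show "short_products T \<subseteq> carrier G" using T(2) by (auto simp: short_products_def subset_iff)
  show "finite (short_products T)" using T(1) by (simp add: short_products_def)
  show "inv x \<in> short_products T" if x: "x \<in> short_products T"
  proof -
    obtain p where p: "p \<in> insert \<one> T \<times> insert \<one> T" "x = fst p \<otimes> snd p"
      using x unfolding short_products_def by blast
    then have c: "fst p \<in> insert \<one> T" "snd p \<in> insert \<one> T" by (simp_all only: mem_Times_iff)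
    then have "fst p \<in> carrier G" "snd p \<in> carrier G" using T(2) by auto
    then have "inv x = inv (snd p) \<otimes> inv (fst p)" unfolding p(2) by (rule inv_mult_group)
    moreover have "inv u \<in> insert \<one> T" if "u \<in> insert \<one> T" for u using that T(3) by auto
    ultimately show ?thesis using I c by simp
  qed
  have "card (short_products T) \<le> card (insert \<one> T \<times> insert \<one> T)"
    unfolding short_products_def by (intro card_image_le) (use T in auto)
  also have "\<dots> = (card (insert \<one> T))\<^sup>2" by (simp only: card_cartesian_product power2_eq_square)
  also have "\<dots> \<le> (card T + 1)\<^sup>2" using T(1) by (intro power_mono) (simp_all add: card_insert_if)
  finally show "card (short_products T) \<le> (card T + 1)\<^sup>2" .
qed

end

text \<open>
  The assumptions on \<open>a\<close> exclude all new triangles at old elements other than \<open>w = a \<otimes> b\<close> for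
  \<open>b = inv a \<otimes> w\<close>, apart from two degenerate situations that cannot always be avoided: \<open>w\<close> may invert
  \<open>a\<close> or commute with \<open>a\<close>.
\<close>

locale booster = group G for G (structure) +
  fixes T w a
  assumes T: "symmetric_subset T" and w: "w \<in> T" and a [simp]: "a \<in> carrier G"
    and a1: "a \<notin> short_products T" and wa: "inv w \<otimes> a \<notin> short_products T"
    and a2: "a \<otimes> a \<notin> short_products T" and a3: "a \<otimes> a \<otimes> a \<noteq> \<one>" "a \<otimes> a \<otimes> a \<noteq> w"
    and twisted: "a \<otimes> inv w \<otimes> a \<in> short_products T \<Longrightarrow> a \<otimes> inv w \<otimes> a = inv w"
    and conjugate: "inv a \<otimes> w \<otimes> a \<in> short_products T \<Longrightarrow> inv a \<otimes> w \<otimes> a = w"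
begin

definition "b = inv a \<otimes> w"

definition "T' = T \<union> {a, inv a, b, inv b}"

lemma T_subset: "T \<subseteq> T'" by (auto simp: T'_def)

lemma T_closed: "t \<in> T \<Longrightarrow> t \<in> carrier G" and T_inv: "t \<in> T \<Longrightarrow> inv t \<in> T"
  and finite_T: "finite T" and one_T: "\<one> \<notin> T"
  using T by (auto simp: symmetric_subset_def)

lemma w_closed [simp]: "w \<in> carrier G" using w by (rule T_closed)

lemma b_closed [simp]: "b \<in> carrier G" by (simp add: b_def)

lemma ab: "a \<otimes> b = w" by (simp add: b_def mult_inv_cancel)

lemma short_inv: "x \<in> carrier G \<Longrightarrow> inv x \<in> short_products T \<longleftrightarrow> x \<in> short_products T"
  using short_products(4)[OF T] by force

lemma short_quotient: "x \<in> T \<Longrightarrow> y \<in> T \<Longrightarrow> x \<otimes> inv y \<in> short_products T"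
  using short_products(3)[OF T _ T_inv] .

lemma new_not_short: "x \<in> {a, inv a, b, inv b} \<Longrightarrow> x \<notin> short_products T"
proof -
  have "inv b = inv w \<otimes> a" by (simp add: b_def inv_mult_group)
  then have "b \<notin> short_products T" using wa short_inv[of b] by simp
  then show "x \<in> {a, inv a, b, inv b} \<Longrightarrow> x \<notin> short_products T"
    using a1 short_inv by auto
qed

lemma new_notin: "x \<in> {a, inv a, b, inv b} \<Longrightarrow> x \<notin> T" "x \<in> {a, inv a, b, inv b} \<Longrightarrow> x \<noteq> \<one>"
  using new_not_short short_products(1,2)[OF T] by blast+

lemma T'_closed: "x \<in> T' \<Longrightarrow> x \<in> carrier G"
  using T_closed by (auto simp: T'_def)

lemma T'_symmetric: "symmetric_subset T'"
  unfolding symmetric_subset_def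
  using finite_T one_T T_inv T'_closed new_notin(2) by (auto simp: T'_def)

lemma T'_card: "card T' \<le> card T + 4"
proof -
  have "card T' \<le> card T + card {a, inv a, b, inv b}" unfolding T'_def by (rule card_Un_le)
  then show ?thesis using card_length[of "[a, inv a, b, inv b]"] by simp
qed

lemma right_factor: "x \<in> carrier G \<Longrightarrow> y \<in> carrier G \<Longrightarrow> x \<otimes> y = v \<Longrightarrow> x = v \<otimes> inv y"
  and left_factor: "x \<in> carrier G \<Longrightarrow> y \<in> carrier G \<Longrightarrow> x \<otimes> y = v \<Longrightarrow> y = inv x \<otimes> v"
  by (auto simp: m_assoc inv_mult_cancel)

lemma a_inv_b: "a \<otimes> inv b = a \<otimes> inv w \<otimes> a" by (simp add: b_def group_word_simps)

lemma a_inv_b_short: "a \<otimes> inv b \<in> short_products T \<Longrightarrow> a \<otimes> inv b = inv w"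
  using twisted by (simp add: a_inv_b)

lemma ba_short: "b \<otimes> a \<in> short_products T \<Longrightarrow> b \<otimes> a = w"
  using conjugate by (simp add: b_def)

text \<open>If this element were some \<open>t\<close> in \<open>T\<close>, then
  \<open>a \<otimes> a = w \<otimes> inv t\<close> would be short.\<close>

lemma inv_a_b: "inv a \<otimes> b \<notin> T"
proof
  assume t: "inv a \<otimes> b \<in> T"
  have "w \<otimes> inv (inv a \<otimes> b) = a \<otimes> a" by (simp add: b_def group_word_simps)
  then show False using short_quotient[OF w t] a2 by simp
qed

text \<open>Membership makes \<open>a \<otimes> inv b\<close> short, and \<open>twisted\<close> then
  forces \<open>b = w \<otimes> a\<close>. Comparison with \<open>b = inv a \<otimes> w\<close>
  shows that \<open>w\<close> inverts \<open>a\<close>. This is the source of the exceptional change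
  at w^2.\<close>

lemma bb_in_T:
  assumes "b \<otimes> b \<in> T"
  shows "b \<otimes> b = w \<otimes> w" "inverts w a"
proof -
  have "a \<otimes> inv b = w \<otimes> inv (b \<otimes> b)"
    by (simp add: b_def group_word_simps)
  then have "a \<otimes> inv b \<in> short_products T" using short_quotient[OF w assms] by simp
  then have e: "a \<otimes> inv b = inv w" by (rule a_inv_b_short)
  have "b \<otimes> inv a = inv (a \<otimes> inv b)" by (simp add: inv_mult_group)
  then have "b \<otimes> inv a = w" using e by simp
  then have "b = w \<otimes> a" by (metis a b_closed inv_closed inv_inv right_factor)
  then show "inverts w a" by (simp add: inverts_def b_def)
  have "b \<otimes> b = w \<otimes> (a \<otimes> b)" using \<open>b = w \<otimes> a\<close> by (simp add: m_assoc)
  then show "b \<otimes> b = w \<otimes> w" by (simp add: ab)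
qed

text \<open>Up to inversion the non-trivial products are \<open>a \<otimes> a\<close>,
  \<open>a \<otimes> b\<close>, \<open>a \<otimes> inv b\<close>, \<open>inv a \<otimes> b\<close>,
  \<open>b \<otimes> a\<close> and \<open>b \<otimes> b\<close>. The first and fourth never lie in
  \<open>T\<close>; the second, third and fifth can only be \<open>w\<close> or
  \<open>inv w\<close>; the last is covered by \<open>bb_in_T\<close>.\<close>

lemma new_product_in_T:
  assumes x: "x \<in> {a, inv a, b, inv b}" and y: "y \<in> {a, inv a, b, inv b}" and t: "x \<otimes> y \<in> T"
  shows "x \<otimes> y \<in> {w, inv w} \<or> inverts w a \<and> x \<otimes> y \<in> {w \<otimes> w, inv (w \<otimes> w)}"
proof -
  have s: "z \<in> T \<Longrightarrow> z \<in> short_products T" for z using short_products(2)[OF T] by blast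
  have inv_T: "inv (u \<otimes> v) \<in> T \<Longrightarrow> u \<otimes> v \<in> T" if "u \<in> carrier G" "v \<in> carrier G" for u v
    using T_inv[of "inv (u \<otimes> v)"] that by simp
  have aa: "a \<otimes> a \<notin> T" using a2 s by blast
  have I: "inv a \<otimes> inv a = inv (a \<otimes> a)" "inv b \<otimes> a = inv (inv a \<otimes> b)" "inv a \<otimes> inv b = inv (b \<otimes> a)"
    "b \<otimes> inv a = inv (a \<otimes> inv b)" "inv b \<otimes> inv b = inv (b \<otimes> b)" "inv b \<otimes> inv a = inv (a \<otimes> b)"
    by (simp_all add: inv_mult_group)
  consider "x \<otimes> y = a \<otimes> a" | "x \<otimes> y = \<one>" | "x \<otimes> y = a \<otimes> b" | "x \<otimes> y = a \<otimes> inv b"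
    | "x \<otimes> y = inv (a \<otimes> a)" | "x \<otimes> y = inv a \<otimes> b" | "x \<otimes> y = inv (b \<otimes> a)"
    | "x \<otimes> y = b \<otimes> a" | "x \<otimes> y = inv (a \<otimes> inv b)" | "x \<otimes> y = b \<otimes> b"
    | "x \<otimes> y = inv (inv a \<otimes> b)" | "x \<otimes> y = inv (a \<otimes> b)" | "x \<otimes> y = inv (b \<otimes> b)"
    using x y I by (elim insertE emptyE) simp_all
  then show ?thesis
  proof cases
    case 1 then show ?thesis using t aa by simp
  next
    case 2 then show ?thesis using t one_T by simp
  next
    case 3 then show ?thesis by (simp add: ab)
  next
    case 4 then show ?thesis using t s a_inv_b_short by simp
  next
    case 5 then show ?thesis using t aa inv_T[of a a] by simp
  next
    case 6 then show ?thesis using t inv_a_b by simp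
  next
    case 7
    then have "b \<otimes> a = w" using t s ba_short inv_T[of b a] by simp
    then show ?thesis using 7 by simp
  next
    case 8 then show ?thesis using t s ba_short by simp
  next
    case 9
    then have "a \<otimes> inv b = inv w" using t s a_inv_b_short inv_T[of a "inv b"] by simp
    then show ?thesis using 9 by simp
  next
    case 10 then show ?thesis using t bb_in_T by simp
  next
    case 11 then show ?thesis using t inv_a_b inv_T[of "inv a" b] by simp
  next
    case 12 then show ?thesis by (simp add: ab)
  next
    case 13
    then have "b \<otimes> b \<in> T" using t inv_T[of b b] by simp
    then show ?thesis using 13 bb_in_T[OF \<open>b \<otimes> b \<in> T\<close>] by simp
  qed
qed

text \<open>If one factor were old and the other new, the new one would be a quotient of two
  elements of \<open>T\<close>, hence short. So both factors are new.\<close>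

lemma triangle_old:
  assumes "x \<in> T'" "y \<in> T'" "x \<otimes> y \<in> T" "x \<notin> T \<or> y \<notin> T"
  shows "x \<otimes> y \<in> {w, inv w} \<or> inverts w a \<and> x \<otimes> y \<in> {w \<otimes> w, inv (w \<otimes> w)}"
proof -
  have c: "x \<in> carrier G" "y \<in> carrier G" using assms T'_closed by auto
  have "x \<notin> T"
  proof
    assume "x \<in> T"
    then have "inv x \<otimes> (x \<otimes> y) \<in> short_products T"
      using short_products(3)[OF T T_inv] assms(3) by blast
    then show False
      using \<open>x \<in> T\<close> assms(2,4) c new_not_short[of y] by (auto simp: inv_mult_cancel T'_def)
  qed
  moreover have "y \<notin> T"
  proof
    assume "y \<in> T"
    then have "(x \<otimes> y) \<otimes> inv y \<in> short_products T"
      using short_quotient assms(3) by blast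
    then have "x \<in> short_products T" using c by (simp add: m_assoc)
    then show False using \<open>x \<notin> T\<close> assms(1) new_not_short[of x] by (auto simp: T'_def)
  qed
  ultimately have "x \<in> {a, inv a, b, inv b}" "y \<in> {a, inv a, b, inv b}"
    using assms by (auto simp: T'_def)
  then show ?thesis using new_product_in_T assms(3) by blast
qed

text \<open>The first side determines the second, so confining \<open>x\<close> bounds the number of
  triangles. An old \<open>x\<close> must be \<open>w\<close> or \<open>inv w\<close>;
  \<open>x = a\<close> forces \<open>y = \<one>\<close>; and \<open>x = inv a\<close> forces y =
  a^2, which the conditions on the powers of \<open>a\<close> exclude.\<close>

lemma triangle_a:
  assumes "x \<in> T'" "y \<in> T'" "x \<otimes> y = a"
  shows "x \<in> {inv w, w, inv b, b}"
proof -
  have c: "x \<in> carrier G" "y \<in> carrier G" using assms T'_closed by auto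
  have s: "z \<in> T \<Longrightarrow> z \<in> short_products T" for z using short_products(2)[OF T] by blast
  have x: "x = a \<otimes> inv y" and y: "y = inv x \<otimes> a"
    using right_factor[OF c assms(3)] left_factor[OF c assms(3)] by simp_all
  have y1: "y \<noteq> \<one>" using assms(2) one_T new_notin(2) by (auto simp: T'_def)
  have xT: "x \<in> {w, inv w}" if xT: "x \<in> T"
  proof -
    consider "y \<in> T" | "y = a" | "y = inv a" | "y = b" | "y = inv b"
      using assms(2) by (auto simp: T'_def)
    then show ?thesis
    proof cases
      case 1 then show ?thesis using short_products(3)[OF T xT] assms(3) a1 by metis
    next
      case 2 then show ?thesis using x xT one_T by simp
    next
      case 3 then show ?thesis using x xT s a2 by simp
    next
      case 4 then show ?thesis using x xT s a_inv_b_short by simp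
    next
      case 5 then show ?thesis using x ab by simp
    qed
  qed
  have "x \<noteq> a" using y y1 by auto
  moreover have "x \<noteq> inv a"
  proof
    assume "x = inv a"
    then have y: "y = a \<otimes> a" using y by simp
    consider "y \<in> T" | "y = a" | "y = inv a" | "y = b" | "y = inv b"
      using assms(2) by (auto simp: T'_def)
    then show False
    proof cases
      case 1 then show False using y s a2 by simp
    next
      case 2 then show False using y new_notin(2)[of a] by simp
    next
      case 3
      then have "a \<otimes> a \<otimes> a = inv a \<otimes> a" using y by simp
      then show False using a3 by simp
    next
      case 4
      then have "a \<otimes> (a \<otimes> a) = a \<otimes> b" using y by simp
      then show False using a3(2) by (simp add: ab m_assoc)
    next
      case 5
      then have "a \<otimes> a = inv w \<otimes> a" using y by (simp add: b_def inv_mult_group)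
      then have "a = inv w" by simp
      then show False using a1 s[OF T_inv[OF w]] by simp
    qed
  qed
  ultimately show ?thesis using xT assms(1) by (auto simp: T'_def)
qed

text \<open>The entry \<open>b \<otimes> b\<close> covers both an old \<open>x\<close> paired with
  \<open>inv b\<close> and the case \<open>x = a\<close>, which can occur only when a = b^2. Thus
  four candidates are again enough.\<close>

lemma triangle_b:
  assumes "x \<in> T'" "y \<in> T'" "x \<otimes> y = b"
  shows "x \<in> {w, inv a, inv b, b \<otimes> b}"
proof -
  have c: "x \<in> carrier G" "y \<in> carrier G" using assms T'_closed by auto
  have s: "z \<in> T \<Longrightarrow> z \<in> short_products T" for z using short_products(2)[OF T] by blast
  have x: "x = b \<otimes> inv y" and y: "y = inv x \<otimes> b"
    using right_factor[OF c assms(3)] left_factor[OF c assms(3)] by simp_all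
  have y1: "y \<noteq> \<one>" using assms(2) one_T new_notin(2) by (auto simp: T'_def)
  have xT: "x \<in> {w, b \<otimes> b}" if xT: "x \<in> T"
  proof -
    consider "y \<in> T" | "y = a" | "y = inv a" | "y = b" | "y = inv b"
      using assms(2) by (auto simp: T'_def)
    then show ?thesis
    proof cases
      case 1 then show ?thesis
        using short_products(3)[OF T xT 1] assms(3) new_not_short[of b] by auto
    next
      case 2
      then have xi: "inv x = a \<otimes> inv b" using x by (simp add: inv_mult_group)
      then have "inv x = inv w" using a_inv_b_short s T_inv[OF xT] by simp
      then show ?thesis using c by (metis inv_inv insertI1 w_closed)
    next
      case 3 then show ?thesis using x xT s ba_short by simp
    next
      case 4 then show ?thesis using x xT one_T by simp
    next
      case 5 then show ?thesis using x by simp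
    qed
  qed
  have "x \<noteq> b" using y y1 by auto
  moreover have "x = b \<otimes> b" if xa: "x = a"
  proof -
    have y: "y = inv a \<otimes> b" using y xa by simp
    have ay: "a \<otimes> y = b" using assms(3) xa by simp
    consider "y \<in> T" | "y = a" | "y = inv a" | "y = b" | "y = inv b"
      using assms(2) by (auto simp: T'_def)
    then show ?thesis
    proof cases
      case 1 then show ?thesis using y inv_a_b by simp
    next
      case 2
      then have "a \<otimes> (a \<otimes> a) = w" using ay ab by simp
      then show ?thesis using a3(2) by (simp add: m_assoc)
    next
      case 3 then show ?thesis using ay new_notin(2)[of b] by simp
    next
      case 4 then show ?thesis using ay new_notin(2)[of a] by simp
    next
      case 5
      then have "a = b \<otimes> inv (inv b)" using ay by (intro right_factor) simp_all
      then show ?thesis using xa by simp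
    qed
  qed
  ultimately show ?thesis using xT assms(1) by (auto simp: T'_def)
qed

text \<open>The bound does not depend on \<open>T\<close>, so words are separated from all auxiliary
  elements as soon as their counts exceed four.\<close>

lemma triangles_new:
  assumes "v \<in> T' - T"
  shows "triangles T' v \<le> 4"
proof -
  have 4: "card Y \<le> 4" if "Y \<subseteq> {p, q, r, s}" for Y and p q r s :: 'a
    using card_mono[OF _ that] card_length[of "[p, q, r, s]"] by simp
  have fac: "x \<otimes> (inv x \<otimes> z) = z" if "x \<in> T'" "z \<in> carrier G" for x z
    using that T'_closed by (simp add: mult_inv_cancel)
  have "x \<in> {inv w, w, inv b, b}" if "x \<in> T'" "inv x \<otimes> a \<in> T'" for x
    by (rule triangle_a[OF that fac[OF that(1) a]])
  then have "triangles T' a \<le> 4" unfolding triangles_def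
    by (intro 4[of _ "inv w" w "inv b" b] subsetI) simp
  moreover have "x \<in> {w, inv a, inv b, b \<otimes> b}" if "x \<in> T'" "inv x \<otimes> b \<in> T'" for x
    by (rule triangle_b[OF that fac[OF that(1) b_closed]])
  then have "triangles T' b \<le> 4" unfolding triangles_def
    by (intro 4[of _ w "inv a" "inv b" "b \<otimes> b"] subsetI) simp
  ultimately show ?thesis
    using assms triangles_inv[OF T'_symmetric, of a] triangles_inv[OF T'_symmetric, of b]
    by (auto simp: T'_def)
qed

lemma triangles_target: "triangles T w < triangles T' w"
  unfolding triangles_def
proof (rule psubset_card_mono)
  show "finite {x \<in> T'. inv x \<otimes> w \<in> T'}" using finite_T by (simp add: T'_def)
  have "a \<in> {x \<in> T'. inv x \<otimes> w \<in> T'}" by (simp add: T'_def b_def)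
  moreover have "a \<notin> T" using new_notin(1) by simp
  ultimately show "{x \<in> T. inv x \<otimes> w \<in> T} \<subset> {x \<in> T'. inv x \<otimes> w \<in> T'}"
    using T_subset by blast
qed

lemma triangles_unchanged:
  assumes t: "t \<in> T" "t \<notin> {w, inv w}" "t \<in> {w \<otimes> w, inv (w \<otimes> w)} \<Longrightarrow> \<not> inverts w a"
  shows "triangles T' t = triangles T t"
proof -
  have "x \<in> T \<and> inv x \<otimes> t \<in> T" if "x \<in> T'" "inv x \<otimes> t \<in> T'" for x
  proof -
    have e: "x \<otimes> (inv x \<otimes> t) = t"
      using T'_closed[OF that(1)] T_closed[OF t(1)] by (simp add: mult_inv_cancel)
    show ?thesis
    proof (rule ccontr)
      assume "\<not> ?thesis"
      then have "t \<in> {w, inv w} \<or> inverts w a \<and> t \<in> {w \<otimes> w, inv (w \<otimes> w)}"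
        using triangle_old[OF that] t(1) unfolding e by blast
      then show False using t by blast
    qed
  qed
  then have "{x \<in> T'. inv x \<otimes> t \<in> T'} = {x \<in> T. inv x \<otimes> t \<in> T}" using T_subset by blast
  then show ?thesis by (simp add: triangles_def)
qed

end

section \<open>A union bound for choosing parameters\<close>

lemma card_preimage_le:
  assumes "finite E" "inj_on f C"
  shows "card {c \<in> C. f c \<in> E} \<le> card E"
  by (rule card_inj_on_le[of f]) (use assms in \<open>auto intro: inj_on_subset\<close>)

text \<open>By injectivity each condition rules out at most \<open>card E\<close> parameters.
  Pairing functions with forbidden sets in a list lets all conditions be counted at once.\<close>

lemma exists_avoiding:
  assumes "finite C" "\<forall>(f, E) \<in> set fs. finite E \<and> inj_on f C"
    and "(\<Sum>(f, E) \<leftarrow> fs. card E) < card C"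
  shows "\<exists>c \<in> C. \<forall>(f, E) \<in> set fs. f c \<notin> E"
  using assms
proof (induction fs arbitrary: C)
  case Nil
  then show ?case by (metis card.empty empty_iff empty_set equals0I less_zeroE)
next
  case (Cons fE fs)
  obtain f E where fE: "fE = (f, E)" by (cases fE)
  let ?C = "{c \<in> C. f c \<notin> E}"
  have "card C \<le> card ?C + card {c \<in> C. f c \<in> E}"
  proof -
    have "?C \<union> {c \<in> C. f c \<in> E} = C" by auto
    then show ?thesis using card_Un_le[of ?C "{c \<in> C. f c \<in> E}"] by argo
  qed
  moreover have "card {c \<in> C. f c \<in> E} \<le> card E"
    using Cons.prems(2) fE by (intro card_preimage_le) auto
  ultimately have "(\<Sum>(f, E) \<leftarrow> fs. card E) < card ?C" using Cons.prems(3) fE by simp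
  moreover have "\<forall>(f, E) \<in> set fs. finite E \<and> inj_on f ?C"
    using Cons.prems(2) by (auto intro: inj_on_subset)
  ultimately have "\<exists>c \<in> ?C. \<forall>(f, E) \<in> set fs. f c \<notin> E"
    using Cons.prems(1) by (intro Cons.IH) auto
  then show ?case using fE by auto
qed

context group
begin

lemma inverts_pow:
  assumes [simp]: "w \<in> carrier G" "a \<in> carrier G" and "inverts w a"
  shows "inverts w (a [^] (n::nat))"
proof (induction n)
  case (Suc n)
  have "w \<otimes> (a [^] n \<otimes> a) = w \<otimes> a [^] n \<otimes> a" by (simp add: m_assoc)
  also have "\<dots> = inv (a [^] n) \<otimes> (w \<otimes> a)" using Suc by (simp add: inverts_def m_assoc)
  also have "\<dots> = inv (a \<otimes> a [^] n) \<otimes> w"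
    using assms(3) by (simp add: inverts_def m_assoc inv_mult_group)
  also have "a \<otimes> a [^] n = a [^] n \<otimes> a" using nat_pow_Suc2[of a n] by simp
  finally show ?case by (simp add: inverts_def)
qed (simp add: inverts_def)

text \<open>Identifies the exceptional outcome of \<open>twisted\<close> in \<open>booster\<close>
  with \<open>w\<close> inverting \<open>a\<close>.\<close>

lemma inverts_twisted:
  assumes [simp]: "w \<in> carrier G" "a \<in> carrier G"
  shows "a \<otimes> inv w \<otimes> a = inv w \<longleftrightarrow> inverts w a"
proof
  assume e: "a \<otimes> inv w \<otimes> a = inv w"
  have "inv a \<otimes> w = w \<otimes> inv w \<otimes> inv a \<otimes> w" by simp
  also have "\<dots> = w \<otimes> (a \<otimes> inv w \<otimes> a) \<otimes> inv a \<otimes> w" unfolding e ..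
  also have "\<dots> = w \<otimes> a" by (simp add: group_word_simps)
  finally show "inverts w a" by (simp add: inverts_def)
next
  assume "inverts w a"
  then have e: "w \<otimes> a = inv a \<otimes> w" by (simp add: inverts_def)
  show "a \<otimes> inv w \<otimes> a = inv w"
  proof -
    have "w = a \<otimes> (w \<otimes> a)" unfolding e by (simp add: mult_inv_cancel)
    then have "inv w = inv (a \<otimes> (w \<otimes> a))" by simp
    then have "inv w = inv a \<otimes> (inv w \<otimes> inv a)" by (simp add: inv_mult_group m_assoc)
    then have "a \<otimes> inv w \<otimes> a = a \<otimes> (inv a \<otimes> (inv w \<otimes> inv a)) \<otimes> a" by simp
    then show ?thesis by (simp add: group_word_simps)
  qed
qed

lemma conjugate_commutes:
  assumes [simp]: "w \<in> carrier G" "a \<in> carrier G"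
  shows "inv a \<otimes> w \<otimes> a = w \<longleftrightarrow> w \<otimes> a = a \<otimes> w"
  by (metis assms inv_closed inv_solve_left m_assoc m_closed)

end

section \<open>Auxiliary elements among the powers of an element of large order\<close>

locale long_power = group G for G (structure) +
  fixes h N
  assumes h [simp]: "h \<in> carrier G" and order: "\<And>i::nat. 0 < i \<Longrightarrow> i \<le> N \<Longrightarrow> h [^] i \<noteq> \<one>"
begin

lemma pow_inj: "inj_on (\<lambda>i::nat. h [^] i) {..N}"
proof (rule linorder_inj_onI)
  fix i j :: nat assume "i < j" "i \<in> {..N}" "j \<in> {..N}"
  then have "h [^] (j - i) \<noteq> \<one>" by (intro order) auto
  moreover have "h [^] j = h [^] i \<otimes> h [^] (j - i)" using \<open>i < j\<close> by (simp add: nat_pow_mult)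
  ultimately show "h [^] i \<noteq> h [^] j" by simp
qed auto

lemma pow_multiple_inj:
  assumes "0 < p" "p * K \<le> N"
  shows "inj_on (\<lambda>k::nat. h [^] (p * k)) {1..K}"
proof (rule inj_onI)
  fix k l assume kl: "k \<in> {1..K}" "l \<in> {1..K}" and e: "h [^] (p * k) = h [^] (p * l)"
  have "p * k \<in> {..N}" "p * l \<in> {..N}"
    using order_trans[OF mult_le_mono2 assms(2)] kl by auto
  then have "p * k = p * l" using e pow_inj by (auto dest: inj_onD)
  then show "k = l" using assms(1) by simp
qed

lemma inj_on_mult_left:
  assumes "inj_on f C" "f ` C \<subseteq> carrier G" "z \<in> carrier G"
  shows "inj_on (\<lambda>c. z \<otimes> f c) C"
proof (rule inj_onI)
  fix x y assume xy: "x \<in> C" "y \<in> C" "z \<otimes> f x = z \<otimes> f y"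
  then have "f x = f y" using assms(2,3) by (metis Units_eq Units_l_cancel image_subset_iff)
  then show "x = y" using assms(1) xy by (auto dest: inj_onD)
qed

lemma pow_pow: "(h [^] (i::nat)) \<otimes> h [^] (j::nat) = h [^] (i + j)"
  by (simp add: nat_pow_mult)

text \<open>Unlike \<open>inverts w a\<close>, this depends neither on the current \<open>T\<close>
  nor on the chosen \<open>a\<close>, so the words can be ordered by it in advance.\<close>

definition inverts_small_power :: "nat \<Rightarrow> 'a \<Rightarrow> bool" where
  "inverts_small_power L w \<longleftrightarrow> (\<exists>p \<in> {1..L}. inverts w (h [^] p))"

text \<open>If \<open>w\<close> inverts h^p and w^2 inverts h^q, then w^2 both commutes with and
  inverts h^(pq), so h^(2pq) = 1, contrary to the bound on the order.\<close>

lemma inverts_small_power_square: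
  assumes w [simp]: "w \<in> carrier G" and "inverts_small_power L w" "2 * L\<^sup>2 \<le> N"
  shows "\<not> inverts_small_power L (w \<otimes> w)"
proof
  assume "inverts_small_power L (w \<otimes> w)"
  then obtain p q where p: "p \<in> {1..L}" "inverts w (h [^] p)"
    and q: "q \<in> {1..L}" "inverts (w \<otimes> w) (h [^] q)"
    using assms(2) by (auto simp: inverts_small_power_def)
  have "inverts w (h [^] (p * q))" using inverts_pow[OF w _ p(2), of q] by (simp add: nat_pow_pow)
  then have c: "w \<otimes> w \<otimes> h [^] (p * q) = h [^] (p * q) \<otimes> (w \<otimes> w)"
    by (intro inverts_square_commutes) simp_all
  have "inverts (w \<otimes> w) (h [^] (q * p))"
    using inverts_pow[OF _ _ q(2), of p] by (simp add: nat_pow_pow)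
  then have "h [^] (p * q) \<otimes> h [^] (p * q) = \<one>"
    using c by (intro inverts_commuting[of "w \<otimes> w"]) (simp_all add: mult.commute)
  then have "h [^] (2 * (p * q)) = \<one>" by (simp add: pow_pow mult_2)
  moreover have "p * q \<le> L\<^sup>2" using p(1) q(1) by (simp add: power2_eq_square mult_mono)
  ultimately show False using order[of "2 * (p * q)"] p(1) q(1) assms(3) by auto
qed

text \<open>\<open>L\<close> is the number of candidate exponents: at most five conditions avoid the
  short products, and the cube avoids two more values. The exponents that occur are at most 3 L^2,
  which explains the demand on \<open>N\<close>.\<close>

lemma booster_exists:
  assumes T: "symmetric_subset T" and w: "w \<in> T"
    and L: "5 * (card T + 1)\<^sup>2 + 2 < L" and N: "3 * (L * L) \<le> N"
  obtains a where "booster G T w a" "inverts w a \<Longrightarrow> inverts_small_power L w"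
proof -
  note result = that
  let ?V = "short_products T"
  have V: "finite ?V" "\<one> \<in> ?V" and 5: "5 * card ?V + 2 < L"
    using short_products[OF T] L by auto
  have [simp]: "w \<in> carrier G" using T w by (auto simp: symmetric_subset_def)
  have finish: thesis
    if "a \<in> carrier G" "a \<notin> ?V" "inv w \<otimes> a \<notin> ?V" "a \<otimes> a \<notin> ?V" "a \<otimes> a \<otimes> a \<notin> {\<one>, w}"
      "a \<otimes> inv w \<otimes> a \<in> ?V \<Longrightarrow> inverts w a" "inv a \<otimes> w \<otimes> a \<in> ?V \<Longrightarrow> w \<otimes> a = a \<otimes> w"
      "inverts w a \<Longrightarrow> inverts_small_power L w" for a
  proof (rule result[of a])
    show "booster G T w a"
      using that T w
      by (intro booster.intro booster_axioms.intro is_group) (auto simp: inverts_twisted conjugate_commutes)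
  qed (rule that(8))
  have L1: "0 < L" and L3: "3 * L \<le> N" using 5 N by (auto simp: mult_le_mono intro: order_trans[OF _ N])
  have two: "card {\<one>, w} \<le> 2" by (simp add: card_insert_if)
  \<comment> \<open>The parameter \<open>z\<close> will be \<open>w\<close> or \<open>inv w\<close>,
    according to which degenerate condition remains to be avoided.\<close>
  have multiples: "\<exists>a. a \<in> carrier G \<and> a \<notin> ?V \<and> inv w \<otimes> a \<notin> ?V \<and> a \<otimes> a \<notin> ?V \<and> a \<otimes> a \<otimes> a \<notin> {\<one>, w} \<and>
      z \<otimes> (a \<otimes> a) \<notin> ?V \<and> (\<exists>k::nat. a = (h [^] p) [^] k)"
    if p: "p \<in> {1..L}" and [simp]: "z \<in> carrier G" for z p
  proof -
    have "p * L \<le> L * L" using p by simp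
    then have pL: "3 * (p * L) \<le> N" using N by linarith
    have inj: "inj_on (\<lambda>k. h [^] (p * k)) {1..L}" "inj_on (\<lambda>k. h [^] (2 * p * k)) {1..L}"
      "inj_on (\<lambda>k. h [^] (3 * p * k)) {1..L}"
      by (rule pow_multiple_inj; use p pL in \<open>simp add: mult.assoc\<close>)+
    let ?fs = "[(\<lambda>k. h [^] (p * k), ?V), (\<lambda>k. inv w \<otimes> h [^] (p * k), ?V), (\<lambda>k. h [^] (2 * p * k), ?V),
      (\<lambda>k. z \<otimes> h [^] (2 * p * k), ?V), (\<lambda>k. h [^] (3 * p * k), {\<one>, w})]"
    have "\<exists>k \<in> {1..L}. \<forall>(f, E) \<in> set ?fs. f k \<notin> E"
    proof (rule exists_avoiding)
      show "\<forall>(f, E) \<in> set ?fs. finite E \<and> inj_on f {1..L}"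
        using inj V by (auto intro!: inj_on_mult_left)
      show "(\<Sum>(f, E) \<leftarrow> ?fs. card E) < card {1..L}" using 5 two by simp
    qed simp
    then obtain k where k: "h [^] (p * k) \<notin> ?V" "inv w \<otimes> h [^] (p * k) \<notin> ?V" "h [^] (2 * p * k) \<notin> ?V"
      "z \<otimes> h [^] (2 * p * k) \<notin> ?V" "h [^] (3 * p * k) \<notin> {\<one>, w}"
      by auto
    have "2 * p * k = p * k + p * k" "3 * p * k = p * k + p * k + p * k" by simp_all
    then have "h [^] (p * k) \<otimes> h [^] (p * k) = h [^] (2 * p * k)"
      "h [^] (p * k) \<otimes> h [^] (p * k) \<otimes> h [^] (p * k) = h [^] (3 * p * k)"
      by (simp_all only: pow_pow)
    then show ?thesis using k by (intro exI[of _ "h [^] (p * k)"]) (auto simp: nat_pow_pow)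
  qed
  \<comment> \<open>If a small power of \<open>h\<close> is inverted by or commutes with \<open>w\<close>, then its powers satisfy one of the
    two degenerate conditions and the other becomes a condition on \<open>a \<otimes> a\<close>. Otherwise both
    \<open>h\<^sup>c w\<inverse> h\<^sup>c\<close> and \<open>h\<^sup>-\<^sup>c w h\<^sup>c\<close> are injective in \<open>c \<le> L\<close> and meet the short products rarely.\<close>
  consider p where "p \<in> {1..L}" "inverts w (h [^] p)"
    | p where "p \<in> {1..L}" "w \<otimes> h [^] p = h [^] p \<otimes> w"
    | "\<forall>p \<in> {1..L}. \<not> inverts w (h [^] p) \<and> w \<otimes> h [^] p \<noteq> h [^] p \<otimes> w"
    by blast
  then show thesis
  proof cases
    case 1
    obtain a k where a: "a \<in> carrier G" "a \<notin> ?V" "inv w \<otimes> a \<notin> ?V" "a \<otimes> a \<notin> ?V" "a \<otimes> a \<otimes> a \<notin> {\<one>, w}"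
      "w \<otimes> (a \<otimes> a) \<notin> ?V" and k: "a = (h [^] p) [^] (k::nat)"
      using multiples[OF 1(1), of w] by auto
    have i: "inverts w a" unfolding k by (rule inverts_pow) (use 1 in auto)
    then have "inv a \<otimes> w \<otimes> a = w \<otimes> (a \<otimes> a)" using a(1) by (simp add: inverts_def flip: m_assoc)
    then show thesis
      using a i 1 by (intro finish[of a]) (auto simp: inverts_small_power_def)
  next
    case 2
    obtain a k where a: "a \<in> carrier G" "a \<notin> ?V" "inv w \<otimes> a \<notin> ?V" "a \<otimes> a \<notin> ?V" "a \<otimes> a \<otimes> a \<notin> {\<one>, w}"
      "inv w \<otimes> (a \<otimes> a) \<notin> ?V" and k: "a = (h [^] p) [^] (k::nat)"
      using multiples[OF 2(1), of "inv w"] by auto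
    have c: "w \<otimes> a = a \<otimes> w"
      unfolding k using group_commutes_pow[of "h [^] p" w k] 2 by simp
    then have "inv w \<otimes> a = a \<otimes> inv w" using inv_commute_iff[of w a] a(1) by simp
    then have "a \<otimes> inv w \<otimes> a = inv w \<otimes> a \<otimes> a" by simp
    then have "a \<otimes> inv w \<otimes> a = inv w \<otimes> (a \<otimes> a)" using a(1) by (simp add: m_assoc)
    moreover have "\<not> inverts w a" using inverts_commuting[of w a] a V(2) c by auto
    ultimately show thesis using a c by (intro finish[of a]) auto
  next
    case 3
    let ?fs = "[(\<lambda>c. h [^] (1 * c), ?V), (\<lambda>c. inv w \<otimes> h [^] (1 * c), ?V), (\<lambda>c. h [^] (2 * c), ?V),
      (\<lambda>c. h [^] (3 * c), {\<one>, w}), (\<lambda>c. h [^] c \<otimes> inv w \<otimes> h [^] c, ?V),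
      (\<lambda>c. inv (h [^] c) \<otimes> w \<otimes> h [^] c, ?V)]"
    have "inj_on (\<lambda>k. h [^] (1 * k)) {1..L}" "inj_on (\<lambda>k. h [^] (2 * k)) {1..L}"
      "inj_on (\<lambda>k. h [^] (3 * k)) {1..L}"
      using L3 by (auto intro!: pow_multiple_inj simp del: mult_1 One_nat_def)
    moreover have "inj_on (\<lambda>c. h [^] c \<otimes> inv w \<otimes> h [^] c) {1..L}"
    proof (rule linorder_inj_onI)
      fix c d assume cd: "c < d" "c \<in> {1..L}" "d \<in> {1..L}"
      have e: "h [^] d = h [^] c \<otimes> h [^] (d - c)" "h [^] d = h [^] (d - c) \<otimes> h [^] c"
        using cd by (simp_all add: pow_pow)
      show "h [^] c \<otimes> inv w \<otimes> h [^] c \<noteq> h [^] d \<otimes> inv w \<otimes> h [^] d"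
      proof
        assume "h [^] c \<otimes> inv w \<otimes> h [^] c = h [^] d \<otimes> inv w \<otimes> h [^] d"
        also have "\<dots> = h [^] c \<otimes> (h [^] (d - c) \<otimes> inv w \<otimes> h [^] (d - c)) \<otimes> h [^] c"
          by (subst e(1), subst e(2)) (simp add: m_assoc)
        \<comment> \<open>Cancelling the outer powers turns a collision into the degenerate relation
          for the smaller exponent \<open>d - c\<close>, which this case rules out.\<close>
        finally have "h [^] (d - c) \<otimes> inv w \<otimes> h [^] (d - c) = inv w" by simp
        then have "inverts w (h [^] (d - c))" by (simp add: inverts_twisted)
        moreover have "d - c \<in> {1..L}" using cd by auto
        ultimately show False using 3 by blast
      qed
    qed auto
    moreover have "inj_on (\<lambda>c. inv (h [^] c) \<otimes> w \<otimes> h [^] c) {1..L}"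
    proof (rule linorder_inj_onI)
      fix c d assume cd: "c < d" "c \<in> {1..L}" "d \<in> {1..L}"
      have e: "h [^] d = h [^] (d - c) \<otimes> h [^] c"
        using cd by (simp_all add: pow_pow)
      show "inv (h [^] c) \<otimes> w \<otimes> h [^] c \<noteq> inv (h [^] d) \<otimes> w \<otimes> h [^] d"
      proof
        assume "inv (h [^] c) \<otimes> w \<otimes> h [^] c = inv (h [^] d) \<otimes> w \<otimes> h [^] d"
        also have "\<dots> = inv (h [^] c) \<otimes> (inv (h [^] (d - c)) \<otimes> w \<otimes> h [^] (d - c)) \<otimes> h [^] c"
          unfolding e by (simp add: inv_mult_group m_assoc)
        finally have "inv (h [^] (d - c)) \<otimes> w \<otimes> h [^] (d - c) = w" by simp
        then have "w \<otimes> h [^] (d - c) = h [^] (d - c) \<otimes> w" by (simp add: conjugate_commutes)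
        moreover have "d - c \<in> {1..L}" using cd by auto
        ultimately show False using 3 by blast
      qed
    qed auto
    ultimately have "\<exists>c \<in> {1..L}. \<forall>(f, E) \<in> set ?fs. f c \<notin> E"
      using V 5 two by (intro exists_avoiding) (auto intro!: inj_on_mult_left)
    then obtain c where c: "c \<in> {1..L}" "h [^] c \<notin> ?V" "inv w \<otimes> h [^] c \<notin> ?V" "h [^] (2 * c) \<notin> ?V"
      "h [^] (3 * c) \<notin> {\<one>, w}" "h [^] c \<otimes> inv w \<otimes> h [^] c \<notin> ?V" "inv (h [^] c) \<otimes> w \<otimes> h [^] c \<notin> ?V"
      by auto
    have "2 * c = c + c" "3 * c = c + c + c" by simp_all
    then have "h [^] c \<otimes> h [^] c = h [^] (2 * c)" "h [^] c \<otimes> h [^] c \<otimes> h [^] c = h [^] (3 * c)"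
      by (simp_all only: pow_pow)
    then show thesis
      using c by (intro finish[of "h [^] c"]) (auto simp: inverts_small_power_def)
  qed
qed

section \<open>Separating the triangle counts word by word\<close>

text \<open>Keeping auxiliary elements out of \<open>short_products W\<close> ensures that none of
  them is the square of a word; a later boost therefore cannot raise their counts above
  four.\<close>

definition boosted :: "'a set \<Rightarrow> 'a set \<Rightarrow> bool" where
  "boosted W T \<longleftrightarrow> symmetric_subset T \<and> W \<subseteq> T \<and>
     (\<forall>v \<in> T - W. triangles T v \<le> 4 \<and> v \<notin> short_products W)"

text \<open>When \<open>w\<close> inverts the auxiliary power of \<open>h\<close>, the new element \<open>b\<close> satisfies \<open>b\<^sup>2 = w\<^sup>2\<close>, which
  perturbs the number of triangles at \<open>w\<^sup>2\<close>; hence the exception.\<close>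

definition keeps :: "nat \<Rightarrow> 'a set \<Rightarrow> 'a \<Rightarrow> 'a set \<Rightarrow> 'a set \<Rightarrow> bool" where
  "keeps L W w T T' \<longleftrightarrow> (\<forall>t \<in> W. t \<notin> {w, inv w} \<and>
     (inverts_small_power L w \<longrightarrow> t \<notin> {w \<otimes> w, inv (w \<otimes> w)}) \<longrightarrow> triangles T' t = triangles T t)"

text \<open>The uniform size bound \<open>B\<close> allows a single \<open>L\<close>, and hence a
  single notion of small power, to serve all steps.\<close>

lemma boost_step:
  assumes W: "symmetric_subset W" and T: "boosted W T" and B: "card T \<le> B" and w: "w \<in> W"
    and L: "5 * (B + 1)\<^sup>2 + 2 < L" "3 * (L * L) \<le> N"
  obtains T' where "boosted W T'" "card T' \<le> card T + 4" "triangles T w < triangles T' w"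
    "keeps L W w T T'"
proof -
  have sT: "symmetric_subset T" and WT: "W \<subseteq> T" using T by (auto simp: boosted_def)
  have "5 * (card T + 1)\<^sup>2 \<le> 5 * (B + 1)\<^sup>2" using B by (simp add: power_mono)
  then have "5 * (card T + 1)\<^sup>2 + 2 < L" using L(1) by linarith
  then obtain a where b: "booster G T w a" and s: "inverts w a \<Longrightarrow> inverts_small_power L w"
    using booster_exists[OF sT _ _ L(2), of w] WT w by blast
  interpret bo: booster G T w a by (rule b)
  have winv: "inv w \<in> W" using W w by (simp add: symmetric_subset_def)
  have sq: "w \<otimes> w \<in> short_products W" "inv (w \<otimes> w) \<in> short_products W"
    using short_products(3,4)[OF W] w by blast+
  have mono: "short_products W \<subseteq> short_products T" using WT by (auto simp: short_products_def)
  have new: "v \<notin> short_products T" if "v \<in> bo.T' - T" for v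
    using that by (intro bo.new_not_short) (auto simp: bo.T'_def)
  have "boosted W bo.T'"
    unfolding boosted_def
  proof (intro conjI ballI bo.T'_symmetric)
    show "W \<subseteq> bo.T'" using WT bo.T_subset by blast
    fix v assume v: "v \<in> bo.T' - W"
    show "v \<notin> short_products W" using v T new mono unfolding boosted_def by blast
    show "triangles bo.T' v \<le> 4"
    proof (cases "v \<in> T")
      case True
      then have old: "triangles T v \<le> 4" "v \<notin> short_products W" using v T by (auto simp: boosted_def)
      have "v \<notin> {w, inv w}" using v w winv by blast
      moreover have "v \<notin> {w \<otimes> w, inv (w \<otimes> w)}" using old(2) sq by blast
      ultimately show ?thesis using bo.triangles_unchanged[OF True] old(1) by simp
    next
      case False
      then show ?thesis using bo.triangles_new v by blast
    qed
  qed
  moreover have "keeps L W w T bo.T'"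
    unfolding keeps_def using bo.triangles_unchanged WT s by blast
  ultimately show thesis using that bo.T'_card bo.triangles_target by blast
qed

text \<open>Every boost strictly raises the count at \<open>w\<close>, so a forbidden value once
  left never returns. At most one boost of four elements is spent on each forbidden value not below
  the starting count.\<close>

lemma boost_until:
  assumes W: "symmetric_subset W" and w: "w \<in> W" and A: "finite A"
    and L: "5 * (B + 1)\<^sup>2 + 2 < L" "3 * (L * L) \<le> N"
    and "boosted W T" "card T + 4 * card {f \<in> A. triangles T w \<le> f} \<le> B"
  shows "\<exists>T'. boosted W T' \<and> card T' \<le> card T + 4 * card {f \<in> A. triangles T w \<le> f} \<and>
    triangles T' w \<notin> A \<and> keeps L W w T T'"
  using assms(6,7)
proof (induction "card {f \<in> A. triangles T w \<le> f}" arbitrary: T rule: less_induct)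
  case less
  show ?case
  proof (cases "triangles T w \<in> A")
    case False
    then show ?thesis using less.prems by (intro exI[of _ T]) (auto simp: keeps_def)
  next
    case True
    have "card T \<le> B" using less.prems(2) by simp
    then obtain T1 where T1: "boosted W T1" "card T1 \<le> card T + 4" "triangles T w < triangles T1 w"
      "keeps L W w T T1"
      using boost_step[OF W less.prems(1) _ w L] by blast
    have lt: "card {f \<in> A. triangles T1 w \<le> f} < card {f \<in> A. triangles T w \<le> f}"
    proof (rule psubset_card_mono)
      have "triangles T w \<in> {f \<in> A. triangles T w \<le> f} - {f \<in> A. triangles T1 w \<le> f}"
        using True T1(3) by simp
      moreover have "{f \<in> A. triangles T1 w \<le> f} \<subseteq> {f \<in> A. triangles T w \<le> f}"
        using T1(3) by auto
      ultimately show "{f \<in> A. triangles T1 w \<le> f} \<subset> {f \<in> A. triangles T w \<le> f}"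
        by blast
    qed (use A in simp)
    then have "card T1 + 4 * card {f \<in> A. triangles T1 w \<le> f} \<le> B"
      using T1(2) less.prems(2) by linarith
    from less.hyps[OF lt T1(1) this]
    obtain T2 where T2: "boosted W T2" "card T2 \<le> card T1 + 4 * card {f \<in> A. triangles T1 w \<le> f}"
      "triangles T2 w \<notin> A" "keeps L W w T1 T2" by blast
    have "card T2 \<le> card T + 4 * card {f \<in> A. triangles T w \<le> f}" using T2(2) T1(2) lt by linarith
    moreover have "keeps L W w T T2" using T1(4) T2(4) by (simp add: keeps_def)
    ultimately show ?thesis using T2 by blast
  qed
qed

lemma inverts_small_power_inv:
  "u \<in> carrier G \<Longrightarrow> inverts_small_power L u \<Longrightarrow> inverts_small_power L (inv u)"
  unfolding inverts_small_power_def using inverts_inv_left by (meson h nat_pow_closed)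

text \<open>
  Elements inverting a small power of \<open>h\<close> come first: boosting such a \<open>w\<close> can disturb \<open>w\<^sup>2\<close>, which
  does not invert a small power and hence has not been treated yet.
\<close>

lemma boost_list:
  assumes W: "symmetric_subset W"
    and L: "5 * (B + 1)\<^sup>2 + 2 < L" "3 * (L * L) \<le> N"
    and "set us \<subseteq> W" "sorted_wrt (\<lambda>u w. inverts_small_power L w \<longrightarrow> inverts_small_power L u) us"
    and "card W + (2 * (length us)\<^sup>2 + 18 * length us) \<le> B"
  shows "\<exists>T. boosted W T \<and> card T \<le> card W + (2 * (length us)\<^sup>2 + 18 * length us) \<and>
    (\<forall>q \<in> set us. triangles T q > 4) \<and>
    (\<forall>q \<in> set us. \<forall>r \<in> set us. triangles T q = triangles T r \<longrightarrow> r \<in> {q, inv q})"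
  using assms(4-6)
proof (induction us rule: rev_induct)
  case Nil
  then show ?case using W by (intro exI[of _ W]) (auto simp: boosted_def)
next
  case (snoc w us)
  let ?n = "length us"
  \<comment> \<open>The increment \<open>4 * ?n + 20\<close> pays for \<open>?n + 5\<close> boosts:
    the forbidden values are 0 to 4 and the counts at the earlier words.\<close>
  have len: "2 * (length (us @ [w]))\<^sup>2 + 18 * length (us @ [w]) = 2 * ?n\<^sup>2 + 18 * ?n + (4 * ?n + 20)"
    by (simp add: power2_eq_square)
  obtain T where T: "boosted W T" "card T \<le> card W + (2 * ?n\<^sup>2 + 18 * ?n)"
    "\<And>q. q \<in> set us \<Longrightarrow> triangles T q > 4"
    "\<And>q r. q \<in> set us \<Longrightarrow> r \<in> set us \<Longrightarrow> triangles T q = triangles T r \<Longrightarrow> r \<in> {q, inv q}"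
  proof -
    have "card W + (2 * ?n\<^sup>2 + 18 * ?n) \<le> B" using snoc.prems(3) unfolding len by linarith
    moreover have "set us \<subseteq> W"
      and "sorted_wrt (\<lambda>u w. inverts_small_power L w \<longrightarrow> inverts_small_power L u) us"
      using snoc.prems(1,2) by (simp_all add: sorted_wrt_append)
    ultimately show thesis using snoc.IH that by blast
  qed
  have w: "w \<in> W" and us: "set us \<subseteq> W" using snoc.prems(1) by auto
  have Wc: "W \<subseteq> carrier G" using W by (simp add: symmetric_subset_def)
  have wc: "w \<in> carrier G" using w Wc by blast
  have sT: "symmetric_subset T" using T(1) by (simp add: boosted_def)
  show ?case
  proof (cases "\<exists>u \<in> set us. w \<in> {u, inv u}")
    \<comment> \<open>The word repeats an earlier one up to inversion, so it has the same count and
      needs no boost.\<close>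
    case True
    then obtain u where u: "u \<in> set us" "w = u \<or> w = inv u" by blast
    have uc: "u \<in> carrier G" using u us Wc by blast
    have tw: "triangles T w = triangles T u" using u(2) triangles_inv[OF sT uc] by auto
    have sym: "x \<in> {u, inv u} \<longleftrightarrow> x \<in> {w, inv w}" for x using u(2) uc by auto
    have "r \<in> {q, inv q}"
      if q: "q \<in> set (us @ [w])" and r: "r \<in> set (us @ [w])" and e: "triangles T q = triangles T r"
      for q r
    proof -
      have rc: "r \<in> carrier G" "q \<in> carrier G" using q r us wc Wc by auto
      consider "q \<in> set us" "r \<in> set us" | "q = w" "r \<in> set us" | "q \<in> set us" "r = w" | "q = w" "r = w"
        using q r by auto
      then show ?thesis
      proof cases
        case 1 then show ?thesis using T(4) e by blast
      next
        case 2 then show ?thesis using T(4)[OF u(1) 2(2)] e tw sym[of r] by simp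
      next
        case 3
        then have "q \<in> {w, inv w}" using T(4)[OF u(1) 3(1)] e tw sym[of q] by simp
        then show ?thesis using 3 wc by auto
      qed simp
    qed
    moreover have "4 < triangles T q" if "q \<in> set (us @ [w])" for q
      using that T(3) tw u(1) by auto
    ultimately show ?thesis using T(1,2) len by (intro exI[of _ T]) auto
  next
    case False
    let ?F = "{0..4} \<union> triangles T ` set us"
    have "card ?F \<le> card {0..4::nat} + card (triangles T ` set us)" by (rule card_Un_le)
    also have "\<dots> \<le> 5 + ?n" using card_image_le[of "set us" "triangles T"] card_length[of us] by simp
    finally have F: "card ?F \<le> ?n + 5" by simp
    have "card {f \<in> ?F. triangles T w \<le> f} \<le> card ?F" by (rule card_mono) auto
    then have c: "4 * card {f \<in> ?F. triangles T w \<le> f} \<le> 4 * ?n + 20" using F by linarith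
    then have "card T + 4 * card {f \<in> ?F. triangles T w \<le> f} \<le> B"
      using T(2) snoc.prems(3) unfolding len by linarith
    then obtain T' where T': "boosted W T'" "card T' \<le> card T + 4 * card {f \<in> ?F. triangles T w \<le> f}"
      "triangles T' w \<notin> ?F" "keeps L W w T T'"
      using boost_until[OF W w _ L T(1), of ?F] by auto
    have "2 * L\<^sup>2 \<le> N" using L(2) by (simp add: power2_eq_square)
    then have sq: "\<not> inverts_small_power L (w \<otimes> w)" if "inverts_small_power L w"
      using inverts_small_power_square[OF wc that] by blast
    have keep: "triangles T' q = triangles T q" if q: "q \<in> set us" for q
    proof -
      have qc: "q \<in> carrier G" using q us Wc by blast
      have "q \<notin> {w \<otimes> w, inv (w \<otimes> w)}" if P: "inverts_small_power L w"
      proof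
        assume q': "q \<in> {w \<otimes> w, inv (w \<otimes> w)}"
        have "inverts_small_power L q" using snoc.prems(2) q P by (simp add: sorted_wrt_append)
        then have "inverts_small_power L (w \<otimes> w)"
          using q' inverts_small_power_inv[OF qc] wc by auto
        then show False using sq[OF P] by blast
      qed
      moreover have "q \<notin> {w, inv w}" using False q qc wc by auto
      ultimately show ?thesis using T'(4) q us unfolding keeps_def by blast
    qed
    have new: "triangles T' w > 4" "\<And>q. q \<in> set us \<Longrightarrow> triangles T' w \<noteq> triangles T q"
      using T'(3) by auto
    have "r \<in> {q, inv q}"
      if q: "q \<in> set (us @ [w])" and r: "r \<in> set (us @ [w])" and e: "triangles T' q = triangles T' r"
      for q r
    proof -
      consider "q \<in> set us" "r \<in> set us" | "q = w" "r \<in> set us" | "q \<in> set us" "r = w" | "q = w" "r = w"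
        using q r by auto
      then show ?thesis
      proof cases
        case 1 then show ?thesis using T(4) e keep by simp
      next
        case 2 then show ?thesis using new(2)[of r] keep[of r] e by simp
      next
        case 3 then show ?thesis using new(2)[of q] keep[of q] e by simp
      qed simp
    qed
    moreover have "4 < triangles T' q" if "q \<in> set (us @ [w])" for q
      using that new(1) keep T(3) by auto
    moreover have "card T' \<le> card W + (2 * (length (us @ [w]))\<^sup>2 + 18 * length (us @ [w]))"
      using T'(2) T(2) c unfolding len by linarith
    ultimately show ?thesis using T'(1) by blast
  qed
qed

text \<open>Closing the words under inversion costs at most 2m elements and boosting at most 2m^2 +
  18m. Elements outside the closure lie in at most four triangles, words in more, so equal counts
  can occur only within the closure.\<close>

lemma separating_set:
  assumes ws: "set ws \<subseteq> carrier G - {\<one>}" and m: "length ws \<le> m" and B: "2 * m\<^sup>2 + 20 * m \<le> B"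
    and L: "5 * (B + 1)\<^sup>2 + 2 < L" "3 * (L * L) \<le> N"
  obtains T where "symmetric_subset T" "set ws \<subseteq> T" "card T \<le> B"
    "\<And>w t. w \<in> set ws \<Longrightarrow> t \<in> T \<Longrightarrow> triangles T t = triangles T w \<Longrightarrow> t \<in> {w, inv w}"
proof -
  let ?P = "inverts_small_power L"
  define us where "us = filter ?P ws @ filter (\<lambda>w. \<not> ?P w) ws"
  define W where "W = set ws \<union> (\<lambda>w. inv w) ` set ws"
  have us: "set us = set ws" "length us = length ws"
    by (auto simp: us_def sum_length_filter_compl)
  have W: "symmetric_subset W"
  proof -
    have "inv x \<noteq> \<one>" if "x \<in> set ws" for x using ws that inv_eq_1_iff[of x] by blast
    then show ?thesis using ws by (auto simp: W_def symmetric_subset_def) metis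
  qed
  have "card W \<le> card (set ws) + card ((\<lambda>w. inv w) ` set ws)" unfolding W_def by (rule card_Un_le)
  also have "\<dots> \<le> 2 * length ws"
    using card_image_le[of "set ws" "\<lambda>w. inv w"] card_length[of ws] by simp
  finally have cW: "card W \<le> 2 * length ws" .
  have "(length ws)\<^sup>2 \<le> m\<^sup>2" using m by (simp add: power_mono)
  then have cB: "card W + (2 * (length us)\<^sup>2 + 18 * length us) \<le> B"
    using cW m B unfolding us(2) by linarith
  have "sorted_wrt (\<lambda>u w. ?P w \<longrightarrow> ?P u) (filter ?P xs)"
    "sorted_wrt (\<lambda>u w. ?P w \<longrightarrow> ?P u) (filter (\<lambda>w. \<not> ?P w) xs)" for xs
    by (induction xs) auto
  then have sorted: "sorted_wrt (\<lambda>u w. ?P w \<longrightarrow> ?P u) us"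
    by (auto simp: us_def sorted_wrt_append)
  have "set us \<subseteq> W" by (auto simp: us W_def)
  from boost_list[OF W L this sorted cB]
  obtain T where T: "boosted W T" "card T \<le> B" "\<And>q. q \<in> set ws \<Longrightarrow> triangles T q > 4"
    "\<And>q r. q \<in> set ws \<Longrightarrow> r \<in> set ws \<Longrightarrow> triangles T q = triangles T r \<Longrightarrow> r \<in> {q, inv q}"
    using cB unfolding us(1) by (meson order_trans)
  have sT: "symmetric_subset T" and "W \<subseteq> T" using T(1) by (auto simp: boosted_def)
  have "t \<in> {w, inv w}" if w: "w \<in> set ws" and t: "t \<in> T" and e: "triangles T t = triangles T w" for w t
  proof -
    have "t \<in> W" using T(1) T(3)[OF w] t e unfolding boosted_def by (metis DiffI not_le)
    then consider "t \<in> set ws" | u where "u \<in> set ws" "t = inv u" by (auto simp: W_def)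
    then show ?thesis
    proof cases
      case 1 then show ?thesis using T(4)[OF w] e by simp
    next
      case 2
      have uc: "u \<in> carrier G" "w \<in> carrier G" using 2 w ws by auto
      have "triangles T u = triangles T w" using triangles_inv[OF sT uc(1)] 2 e by simp
      then have "u \<in> {w, inv w}" using T(4)[OF w 2(1)] by simp
      then show ?thesis using 2 uc by auto
    qed
  qed
  then show thesis using that sT \<open>W \<subseteq> T\<close> T(2) by (auto simp: W_def)
qed

end

context group
begin

section \<open>Graphical regular representations\<close>

lemma symmetric_subset_set_inv:
  assumes "symmetric_subset T"
  shows "set_inv T = T"
proof
  show "set_inv T \<subseteq> T" using assms by (auto simp: symmetric_subset_def SET_INV_def)
  show "T \<subseteq> set_inv T"
  proof
    fix t assume "t \<in> T"
    then have "inv t \<in> T" "t = inv (inv t)" using assms by (auto simp: symmetric_subset_def)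
    then show "t \<in> set_inv T" unfolding SET_INV_def by blast
  qed
qed

lemma cayley_arc_iff:
  assumes "symmetric_subset T" "u \<in> carrier G" "v \<in> carrier G"
  shows "(u, v) \<in> parcs (cayley_graph G T) \<longleftrightarrow> inv u \<otimes> v \<in> T"
  using assms by (simp add: cayley_graph_def symmetric_subset_set_inv)

lemma common_neighbours:
  assumes T: "symmetric_subset T" and [simp]: "u \<in> carrier G" "v \<in> carrier G"
  shows "card {z \<in> carrier G. inv u \<otimes> z \<in> T \<and> inv z \<otimes> v \<in> T} = triangles T (inv u \<otimes> v)"
proof -
  have Tc: "x \<in> carrier G" if "x \<in> T" for x using T that by (auto simp: symmetric_subset_def)
  have "bij_betw (\<lambda>z. inv u \<otimes> z) {z \<in> carrier G. inv u \<otimes> z \<in> T \<and> inv z \<otimes> v \<in> T}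
      {x \<in> T. inv x \<otimes> (inv u \<otimes> v) \<in> T}"
    by (rule bij_betw_byWitness[where f' = "\<lambda>x. u \<otimes> x"])
      (use Tc in \<open>auto simp: group_word_simps\<close>)
  then show ?thesis unfolding triangles_def by (rule bij_betw_same_card)
qed

text \<open>An automorphism preserves the number of common neighbours of two vertices, which is the
  triangle count of their quotient; \<open>sep\<close> then recovers the quotient up to
  inversion.\<close>

lemma automorphism_colour_map:
  assumes T: "symmetric_subset T" and f: "\<phi> \<in> graph_automorphisms (cayley_graph G T)"
    and W: "W \<subseteq> T"
    and sep: "\<And>w t. w \<in> W \<Longrightarrow> t \<in> T \<Longrightarrow> triangles T t = triangles T w \<Longrightarrow> t \<in> {w, inv w}"
  shows "\<phi> \<in> colour_maps W"
proof -
  have pv: "pverts (cayley_graph G T) = carrier G" by (simp add: cayley_graph_def)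
  have bij: "bij_betw \<phi> (carrier G) (carrier G)"
    using f by (simp add: graph_automorphisms_def pv Bij_def)
  then have closed [simp]: "\<phi> g \<in> carrier G" if "g \<in> carrier G" for g
    using that by (auto dest: bij_betwE)
  have adj: "inv (\<phi> u) \<otimes> \<phi> v \<in> T \<longleftrightarrow> inv u \<otimes> v \<in> T" if "u \<in> carrier G" "v \<in> carrier G" for u v
    using f that cayley_arc_iff[OF T] by (simp add: graph_automorphisms_def pv)
  have tri: "triangles T (inv (\<phi> u) \<otimes> \<phi> v) = triangles T (inv u \<otimes> v)"
    if uv: "u \<in> carrier G" "v \<in> carrier G" for u v
  proof -
    let ?A = "{z \<in> carrier G. inv u \<otimes> z \<in> T \<and> inv z \<otimes> v \<in> T}"
    let ?B = "{z \<in> carrier G. inv (\<phi> u) \<otimes> z \<in> T \<and> inv z \<otimes> \<phi> v \<in> T}"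
    have img: "\<phi> ` ?A = ?B"
    proof
      show "\<phi> ` ?A \<subseteq> ?B" using adj uv by auto
      show "?B \<subseteq> \<phi> ` ?A"
      proof
        fix y assume y: "y \<in> ?B"
        then obtain z where "z \<in> carrier G" "y = \<phi> z" using bij by (auto simp: bij_betw_def)
        then show "y \<in> \<phi> ` ?A" using y adj uv by auto
      qed
    qed
    have "inj_on \<phi> (carrier G)" using bij by (simp add: bij_betw_def)
    then have "inj_on \<phi> ?A" by (rule inj_on_subset) blast
    then have "card ?B = card ?A" unfolding img[symmetric] by (rule card_image)
    then show ?thesis
      unfolding common_neighbours[OF T uv] common_neighbours[OF T closed[OF uv(1)] closed[OF uv(2)]] .
  qed
  have "\<phi> (g \<otimes> w) \<in> {\<phi> g \<otimes> w, \<phi> g \<otimes> inv w}" if g: "g \<in> carrier G" and w: "w \<in> W" for g w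
  proof -
    have wT: "w \<in> T" and wc: "w \<in> carrier G"
      using w W T by (auto simp: symmetric_subset_def)
    have gw: "inv g \<otimes> (g \<otimes> w) = w" using g wc by (simp add: inv_mult_cancel)
    have "inv (\<phi> g) \<otimes> \<phi> (g \<otimes> w) \<in> T" using adj[of g "g \<otimes> w"] g wc wT gw by simp
    moreover have "triangles T (inv (\<phi> g) \<otimes> \<phi> (g \<otimes> w)) = triangles T w"
      using tri[of g "g \<otimes> w"] g wc gw by simp
    ultimately have "inv (\<phi> g) \<otimes> \<phi> (g \<otimes> w) \<in> {w, inv w}" using sep[OF w] by blast
    moreover have "\<phi> (g \<otimes> w) = \<phi> g \<otimes> (inv (\<phi> g) \<otimes> \<phi> (g \<otimes> w))"
      using g wc by (simp add: mult_inv_cancel)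
    ultimately show ?thesis by auto
  qed
  then show ?thesis using bij by (simp add: colour_maps_def)
qed

lemma left_multiplication_automorphism:
  assumes T: "symmetric_subset T" and g [simp]: "g \<in> carrier G"
  shows "(\<lambda>k \<in> carrier G. g \<otimes> k) \<in> graph_automorphisms (cayley_graph G T)"
proof -
  have "bij_betw (\<lambda>k \<in> carrier G. g \<otimes> k) (carrier G) (carrier G)"
    by (rule bij_betw_byWitness[where f' = "\<lambda>k. inv g \<otimes> k"])
      (auto simp: group_word_simps)
  moreover have "inv (g \<otimes> u) \<otimes> (g \<otimes> v) = inv u \<otimes> v" if "u \<in> carrier G" "v \<in> carrier G" for u v
    using that by (simp add: group_word_simps)
  ultimately show ?thesis
    using cayley_arc_iff[OF T]
    by (simp add: graph_automorphisms_def cayley_graph_def Bij_def)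
qed

text \<open>An automorphism is a colour map for \<open>W\<close> and therefore commutes with right
  multiplication by every generator, hence by every element. It is then left multiplication by the
  image of \<open>\<one>\<close>.\<close>

lemma pinned_generators_GRR:
  assumes S: "generating_set G S" and ST: "S \<subseteq> T" and T: "symmetric_subset T" and W: "W \<subseteq> T"
    and sep: "\<And>w t. w \<in> W \<Longrightarrow> t \<in> T \<Longrightarrow> triangles T t = triangles T w \<Longrightarrow> t \<in> {w, inv w}"
    and pins: "\<And>x. x \<in> S \<Longrightarrow> pins W x"
  shows "cayley_is_GRR G T"
proof -
  have Tc: "T \<subseteq> carrier G - {\<one>}" using T by (auto simp: symmetric_subset_def)
  have Sc: "S \<subseteq> carrier G" and gen: "generate G S = carrier G"
    using S by (auto simp: generating_set_def)
  have "generate G S \<subseteq> generate G T" using ST Tc by (intro mono_generate) auto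
  moreover have "generate G T \<subseteq> carrier G" using Tc by (intro generate_incl) auto
  ultimately have "generating_set G T" using Tc gen by (auto simp: generating_set_def)
  moreover have "\<phi> \<in> left_multiplications G"
    if f: "\<phi> \<in> graph_automorphisms (cayley_graph G T)" for \<phi>
  proof -
    have \<phi>: "\<phi> \<in> colour_maps W" by (rule automorphism_colour_map[OF T f W sep])
    have Wc: "W \<subseteq> carrier G" using W Tc by blast
    have c: "\<phi> g \<in> carrier G" if "g \<in> carrier G" for g by (rule colour_map_closed[OF \<phi> that])
    have s: "\<phi> (g \<otimes> x) = \<phi> g \<otimes> x" if "g \<in> carrier G" "x \<in> S" for g x
      using pinsD[OF pins[OF that(2)] \<phi> that(1) _ Wc] that Sc by blast
    have all: "\<phi> (g \<otimes> k) = \<phi> g \<otimes> k" if k: "k \<in> generate G S" and g: "g \<in> carrier G" for g k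
      using k g
    proof (induction arbitrary: g)
      case one
      then show ?case using c by simp
    next
      case (incl x)
      then show ?case using s by simp
    next
      case (inv x)
      then have x: "x \<in> carrier G" using Sc by blast
      \<comment> \<open>An inverse generator is treated as a forward step ending at
        \<open>g\<close>.\<close>
      have "\<phi> (g \<otimes> inv x \<otimes> x) = \<phi> (g \<otimes> inv x) \<otimes> x" using s inv x by simp
      then have "\<phi> g = \<phi> (g \<otimes> inv x) \<otimes> x" using inv x by (simp add: m_assoc)
      then show ?case using inv x c by (simp add: m_assoc)
    next
      case (eng x y)
      then have "x \<in> carrier G" "y \<in> carrier G" using generate_incl[OF Sc] by auto
      then show ?case using eng c by (simp add: m_assoc[symmetric])
    qed
    have "\<phi> = (\<lambda>k \<in> carrier G. \<phi> \<one> \<otimes> k)"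
    proof (rule extensionalityI)
      show "\<phi> \<in> extensional (carrier G)"
        using f by (simp add: graph_automorphisms_def cayley_graph_def Bij_def)
      fix k assume "k \<in> carrier G"
      then show "\<phi> k = (\<lambda>k \<in> carrier G. \<phi> \<one> \<otimes> k) k" using all[of k \<one>] gen by simp
    qed auto
    then show ?thesis using c unfolding left_multiplications_def by blast
  qed
  moreover have "left_multiplications G \<subseteq> graph_automorphisms (cayley_graph G T)"
    using left_multiplication_automorphism[OF T] by (auto simp: left_multiplications_def)
  ultimately show ?thesis unfolding cayley_is_GRR_def by blast
qed

lemma cayley_valency:
  assumes T: "symmetric_subset T"
  shows "has_valency (cayley_graph G T) (card T)"
  unfolding has_valency_def
proof (intro ballI)
  fix v assume "v \<in> pverts (cayley_graph G T)"
  then have v: "v \<in> carrier G" by (simp add: cayley_graph_def)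
  have Tc: "t \<in> carrier G" if "t \<in> T" for t using T that by (auto simp: symmetric_subset_def)
  have "out_arcs (with_proj (cayley_graph G T)) v = {e \<in> parcs (cayley_graph G T). fst e = v}"
    by (auto simp: out_arcs_def)
  also have "\<dots> = (\<lambda>t. (v, v \<otimes> t)) ` T"
  proof
    show "{e \<in> parcs (cayley_graph G T). fst e = v} \<subseteq> (\<lambda>t. (v, v \<otimes> t)) ` T"
    proof
      fix e assume e: "e \<in> {e \<in> parcs (cayley_graph G T). fst e = v}"
      then obtain u where u: "e = (v, u)" by (cases e) auto
      have uc: "u \<in> carrier G" using e u by (simp add: cayley_graph_def)
      then have "inv v \<otimes> u \<in> T" using e u cayley_arc_iff[OF T v] by simp
      moreover have "e = (v, v \<otimes> (inv v \<otimes> u))" using u v uc by (simp add: mult_inv_cancel)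
      ultimately show "e \<in> (\<lambda>t. (v, v \<otimes> t)) ` T" by (rule rev_image_eqI)
    qed
    show "(\<lambda>t. (v, v \<otimes> t)) ` T \<subseteq> {e \<in> parcs (cayley_graph G T). fst e = v}"
      using v Tc cayley_arc_iff[OF T v] by (auto simp: inv_mult_cancel)
  qed
  finally have out: "out_arcs (with_proj (cayley_graph G T)) v = (\<lambda>t. (v, v \<otimes> t)) ` T" .
  have "inj_on (\<lambda>t. (v, v \<otimes> t)) T" using v Tc by (auto intro!: inj_onI)
  then show "finite (out_arcs (with_proj (cayley_graph G T)) v) \<and>
      out_degree (with_proj (cayley_graph G T)) v = card T"
    using T unfolding out_degree_def out by (simp add: card_image symmetric_subset_def)
qed

text \<open>The words built for pinning may happen to be trivial, while a connection set must omit
  \<open>\<one>\<close>. The identity as a colour imposes no condition on a map.\<close>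

lemma pins_remove_one:
  assumes "pins W x" "W \<subseteq> carrier G"
  shows "pins (W - {\<one>}) x"
proof -
  have "colour_maps (W - {\<one>}) \<subseteq> colour_maps W"
  proof
    fix \<phi> assume f: "\<phi> \<in> colour_maps (W - {\<one>})"
    have "\<phi> (g \<otimes> w) \<in> {\<phi> g \<otimes> w, \<phi> g \<otimes> inv w}" if "g \<in> carrier G" "w \<in> W" for g w
    proof (cases "w = \<one>")
      case True
      then show ?thesis using that colour_map_closed[OF f] by simp
    next
      case False
      then show ?thesis using f that by (simp add: colour_maps_def)
    qed
    then show "\<phi> \<in> colour_maps W" using f by (simp add: colour_maps_def)
  qed
  then show ?thesis using assms(1) unfolding pins_def by blast
qed

section \<open>Numerical bounds and assembly\<close>

lemma order_at_least_pow:
  assumes "x \<in> carrier G" "order_at_least G x M" "0 < i" "int i < M"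
  shows "x [^] i \<noteq> \<one>"
proof
  assume "x [^] i = \<one>"
  then have "ord x dvd i" using pow_eq_id[OF assms(1)] by simp
  then have "ord x \<noteq> 0" "ord x \<le> i" using assms(3) by (auto dest: dvd_imp_le)
  then show False using assms(2,4) by (simp add: order_at_least_def)
qed

text \<open>The required order is at most 1323 q^4, whereas \<open>F q\<close> is at least 16 q^6;
  for q at least 100 the latter is larger. The slack of 4 between \<open>B\<close> and
  \<open>q\<close> absorbs the subtraction in the bound of (2).\<close>

lemma F_bound:
  assumes "100 \<le> q" "int B \<le> q + 4"
  shows "int (3 * ((5 * (B + 1)\<^sup>2 + 3) * (5 * (B + 1)\<^sup>2 + 3))) < F q"
proof -
  have q2: "100\<^sup>2 \<le> q\<^sup>2" using assms(1) by (intro power_mono) simp_all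
  have "int B + 1 \<le> 2 * q" using assms by linarith
  then have "(int B + 1)\<^sup>2 \<le> (2 * q)\<^sup>2" by (intro power_mono) auto
  then have c: "5 * (int B + 1)\<^sup>2 + 3 \<le> 21 * q\<^sup>2" using q2 by (simp add: power_mult_distrib)
  have "int (3 * ((5 * (B + 1)\<^sup>2 + 3) * (5 * (B + 1)\<^sup>2 + 3)))
      = 3 * (5 * (int B + 1)\<^sup>2 + 3)\<^sup>2"
    unfolding power2_eq_square[of "5 * (int B + 1)\<^sup>2 + 3"] by (simp add: add.commute)
  also have "\<dots> \<le> 3 * (21 * q\<^sup>2)\<^sup>2" using c by (intro mult_left_mono power_mono) auto
  also have "\<dots> = 1323 * (q\<^sup>2 * q\<^sup>2)" by (simp add: power2_eq_square)
  also have "\<dots> < 2 * (2 * q\<^sup>2)\<^sup>2 * (2 * q\<^sup>2)"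
  proof -
    have "1323 * (q\<^sup>2 * q\<^sup>2) < (16 * q\<^sup>2) * (q\<^sup>2 * q\<^sup>2)"
      using q2 assms(1) by (intro mult_strict_right_mono) auto
    also have "\<dots> = 2 * (2 * q\<^sup>2)\<^sup>2 * (2 * q\<^sup>2)" by (simp add: power2_eq_square)
    finally show ?thesis .
  qed
  also have "\<dots> \<le> 2 * (2 * q\<^sup>2 + 3 * q - 2)\<^sup>2 * (2 * q\<^sup>2 + 4 * q - 1)"
    using assms(1) by (intro mult_mono power_mono mult_nonneg_nonneg) auto
  finally show ?thesis by (simp add: F_def)
qed

lemma GRR_from_pins:
  assumes S: "generating_set G S" and x: "x \<in> carrier G" "order_at_least G x (F q)"
    and q: "100 \<le> q" "int B \<le> q + 4" and m: "2 * m\<^sup>2 + 20 * m \<le> B"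
    and words: "x \<otimes> x \<otimes> (x \<otimes> x) \<noteq> \<one> \<Longrightarrow> \<exists>ws. length ws \<le> m \<and> set ws \<subseteq> carrier G \<and>
      S \<subseteq> set ws \<and> (\<forall>y \<in> S. pins (set ws) y)"
  shows "\<exists>T. symmetric_subset T \<and> S \<subseteq> T \<and> cayley_is_GRR G T \<and> card T \<le> B"
proof -
  \<comment> \<open>The least \<open>L\<close> that meets the strict bound of
    \<open>separating_set\<close>; the exponent range 3 L^2 is then the least it accepts.\<close>
  let ?L = "5 * (B + 1)\<^sup>2 + 3"
  have N: "x [^] i \<noteq> \<one>" if "0 < i" "i \<le> 3 * (?L * ?L)" for i :: nat
    using order_at_least_pow[OF x that(1)] F_bound[OF q] that(2) by linarith
  interpret long_power G x "3 * (?L * ?L)"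
    by unfold_locales (use x N in auto)
  have "2 * 2 \<le> ?L * ?L" by (rule mult_le_mono) simp_all
  then have "4 \<le> 3 * (?L * ?L)" by linarith
  then have "x [^] (4::nat) \<noteq> \<one>" by (intro N) auto
  then have "x \<otimes> x \<otimes> (x \<otimes> x) \<noteq> \<one>" using x(1) by (simp add: numeral_eq_Suc m_assoc)
  then obtain ws where ws: "length ws \<le> m" "set ws \<subseteq> carrier G" "S \<subseteq> set ws"
    "\<And>y. y \<in> S \<Longrightarrow> pins (set ws) y"
    using words by blast
  define vs where "vs = filter (\<lambda>w. w \<noteq> \<one>) ws"
  have vs: "set vs = set ws - {\<one>}" by (auto simp: vs_def)
  have len: "length vs \<le> m"
    using ws(1) unfolding vs_def by (rule order_trans[OF length_filter_le])
  have vc: "set vs \<subseteq> carrier G - {\<one>}" using vs ws(2) by blast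
  have L: "5 * (B + 1)\<^sup>2 + 2 < ?L" by simp
  obtain T where T: "symmetric_subset T" "set vs \<subseteq> T" "card T \<le> B"
    "\<And>w t. w \<in> set vs \<Longrightarrow> t \<in> T \<Longrightarrow> triangles T t = triangles T w \<Longrightarrow> t \<in> {w, inv w}"
    by (rule separating_set[OF vc len m L order_refl]) blast
  have "S \<subseteq> set vs" using S ws(3) vs by (auto simp: generating_set_def)
  then have ST: "S \<subseteq> T" using T(2) by blast
  have "pins (set vs) y" if "y \<in> S" for y
    unfolding vs by (rule pins_remove_one[OF ws(4)[OF that] ws(2)])
  then have "cayley_is_GRR G T" by (intro pinned_generators_GRR[OF S ST T(1,2) T(4)])
  then show ?thesis using T ST by blast
qed

lemma card_generating_set:
  assumes "generating_set G S" "finite S" "\<not> comm_group G"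
  shows "2 \<le> card S"
proof -
  have S: "S \<subseteq> carrier G" "generate G S = carrier G"
    using assms(1) by (auto simp: generating_set_def)
  obtain t u where "t \<in> S" "u \<in> S" "t \<otimes> u \<noteq> u \<otimes> t"
    by (rule noncommuting_generators[OF S assms(3)])
  then have "{t, u} \<subseteq> S" "t \<noteq> u" by auto
  then show ?thesis using card_mono[OF assms(2), of "{t, u}"] by simp
qed

lemma GRR_degree_six:
  assumes "\<not> comm_group G" "\<not> generalized_dicyclic G" and S: "generating_set G S" "finite S"
    and x: "x \<in> carrier G" "order_at_least G x (F (32 * int (card S) ^ 6))"
  shows "\<exists>T. symmetric_subset T \<and> S \<subseteq> T \<and> cayley_is_GRR G T \<and> card T \<le> 32 * card S ^ 6"
proof -
  let ?r = "card S"
  have r: "2 \<le> ?r" by (rule card_generating_set[OF S assms(1)])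
  have Sc: "S \<subseteq> carrier G" using S by (auto simp: generating_set_def)
  have r4: "16 \<le> ?r ^ 4" using power_mono[OF r, of 4] by simp
  have r6: "?r ^ 6 = ?r ^ 4 * ?r\<^sup>2" by (simp flip: power_add)
  have r2: "2 * ?r \<le> ?r\<^sup>2" using r by (simp add: power2_eq_square)
  have "16 * ?r\<^sup>2 \<le> ?r ^ 6" unfolding r6 using r4 by (rule mult_le_mono1)
  moreover have "2 * (7 * (?r + 1))\<^sup>2 + 20 * (7 * (?r + 1)) = 98 * ?r\<^sup>2 + 336 * ?r + 238"
    by (simp add: power2_eq_square algebra_simps)
  \<comment> \<open>For \<open>?r\<close> at least 2 the right side is at least 512 times the square
    of \<open>?r\<close>, which dominates the quadratic on the left.\<close>
  ultimately have m: "2 * (7 * (?r + 1))\<^sup>2 + 20 * (7 * (?r + 1)) \<le> 32 * ?r ^ 6"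
    and big: "100 \<le> 32 * ?r ^ 6"
    using r r2 by linarith+
  have "100 \<le> int (32 * ?r ^ 6)" using big by linarith
  then have q: "100 \<le> 32 * int ?r ^ 6" by simp
  show ?thesis
  proof (rule GRR_from_pins[OF S(1) x q _ m])
    assume x4: "x \<otimes> x \<otimes> (x \<otimes> x) \<noteq> \<one>"
    obtain ws where "length ws \<le> 7 * (?r + 1)" "set ws \<subseteq> carrier G" "S \<subseteq> set ws"
      "\<And>y. y \<in> S \<Longrightarrow> pins (set ws) y"
      using pins_generators[OF S(2) Sc assms(2,1) x(1) x4] by blast
    then show "\<exists>ws. length ws \<le> 7 * (?r + 1) \<and> set ws \<subseteq> carrier G \<and> S \<subseteq> set ws \<and>
        (\<forall>y \<in> S. pins (set ws) y)"
      by blast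
  qed simp
qed

lemma GRR_degree_two:
  assumes "\<not> comm_group G" "no_order_4_or_no_char_abelian G" and S: "generating_set G S" "finite S"
    and x: "x \<in> carrier G"
      "order_at_least G x (F (18 * int (card S) ^ 2 + 84 * int (card S) - 4))"
  shows "\<exists>T. symmetric_subset T \<and> S \<subseteq> T \<and> cayley_is_GRR G T \<and> card T \<le> 18 * card S ^ 2 + 84 * card S"
proof -
  let ?r = "card S"
  have r: "2 \<le> ?r" by (rule card_generating_set[OF S assms(1)])
  have Sc: "S \<subseteq> carrier G" "generate G S = carrier G" using S by (auto simp: generating_set_def)
  have r2: "2 * ?r \<le> ?r\<^sup>2" using r by (simp add: power2_eq_square)
  have "2 * (2 * ?r + 3)\<^sup>2 + 20 * (2 * ?r + 3) = 8 * ?r\<^sup>2 + 64 * ?r + 78"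
    by (simp add: power2_eq_square algebra_simps)
  \<comment> \<open>Nearly sharp: for \<open>?r = 2\<close> this reads 238 \<le> 240.\<close>
  then have m: "2 * (2 * ?r + 3)\<^sup>2 + 20 * (2 * ?r + 3) \<le> 18 * ?r\<^sup>2 + 84 * ?r"
    using r r2 by linarith
  have "int (2 * ?r) \<le> int (?r\<^sup>2)" using r2 by linarith
  then have q: "100 \<le> 18 * int ?r ^ 2 + 84 * int ?r - 4" using r by simp
  show ?thesis
  proof (rule GRR_from_pins[OF S(1) x q _ m])
    assume x4: "x \<otimes> x \<otimes> (x \<otimes> x) \<noteq> \<one>"
    obtain ws where "length ws \<le> 2 * ?r + 3" "set ws \<subseteq> carrier G" "S \<subseteq> set ws"
      "\<And>y. y \<in> S \<Longrightarrow> pins (set ws) y"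
      using pins_generators_short[OF S(2) Sc assms(1,2) x(1) x4] by blast
    then show "\<exists>ws. length ws \<le> 2 * ?r + 3 \<and> set ws \<subseteq> carrier G \<and> S \<subseteq> set ws \<and>
        (\<forall>y \<in> S. pins (set ws) y)"
      by blast
  qed simp
qed

end

lemma finite_minimal_generating_set:
  assumes "finitely_generated G"
  obtains S where "finite S" "generating_set G S" "card S = group_rank G"
proof -
  have "\<exists>n S. finite S \<and> generating_set G S \<and> card S = n"
    using assms by (auto simp: finitely_generated_def)
  from LeastI_ex[OF this] show thesis using that unfolding group_rank_def by blast
qed

lemma (in group) symmetric_GRR_valency:
  assumes "symmetric_subset T" "cayley_is_GRR G T" "card T \<le> k"
  shows "has_GRR_of_valency_at_most G k"
  using assms cayley_valency unfolding has_GRR_of_valency_at_most_def by blast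

text \<open>The first two parts apply the degree bounds to a generating set of least size; the third
  applies them to an arbitrary finite \<open>S\<close>, with an element whose order is large in
  terms of \<open>card S\<close>.\<close>

theorem corollary11:
  fixes G :: "('a, 'b) monoid_scheme"
  assumes "group G"
    and "finitely_generated G"
    and "\<not> generalized_dicyclic G"
    and "\<not> comm_group G"
  shows "((\<exists>x \<in> carrier G. order_at_least G x (F (32 * int (group_rank G) ^ 6))) \<longrightarrow>
            has_GRR_of_valency_at_most G (32 * group_rank G ^ 6))
       \<and> (no_order_4_or_no_char_abelian G \<longrightarrow>
            (\<exists>x \<in> carrier G. order_at_least G x
               (F (18 * int (group_rank G) ^ 2 + 84 * int (group_rank G) - 4))) \<longrightarrow>
            has_GRR_of_valency_at_most G (18 * group_rank G ^ 2 + 84 * group_rank G))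
       \<and> ((\<forall>N. \<exists>x \<in> carrier G. order_at_least G x N) \<longrightarrow>
            (\<forall>S. finite S \<and> generating_set G S \<longrightarrow>
               (\<exists>T. finite T \<and> S \<subseteq> T \<and> symmetric_set G T \<and> cayley_is_GRR G T \<and>
                    card T \<le> 32 * card S ^ 6)
             \<and> (no_order_4_or_no_char_abelian G \<longrightarrow>
                 (\<exists>T. finite T \<and> S \<subseteq> T \<and> symmetric_set G T \<and> cayley_is_GRR G T \<and>
                      card T \<le> 18 * card S ^ 2 + 84 * card S))))"
proof -
  interpret group G by fact
  note six = GRR_degree_six[OF assms(4,3)] and two = GRR_degree_two[OF assms(4)]
  have sym: "finite T \<and> symmetric_set G T" if "symmetric_subset T" for T
    using that symmetric_subset_set_inv[OF that] by (simp add: symmetric_set_def symmetric_subset_def)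
  obtain R where R: "finite R" "generating_set G R" "card R = group_rank G"
    by (rule finite_minimal_generating_set[OF assms(2)])
  show ?thesis
  proof (intro conjI impI allI)
    assume "\<exists>x \<in> carrier G. order_at_least G x (F (32 * int (group_rank G) ^ 6))"
    then show "has_GRR_of_valency_at_most G (32 * group_rank G ^ 6)"
      using six[OF R(2,1)] symmetric_GRR_valency unfolding R(3) by blast
  next
    assume "no_order_4_or_no_char_abelian G"
      "\<exists>x \<in> carrier G. order_at_least G x
        (F (18 * int (group_rank G) ^ 2 + 84 * int (group_rank G) - 4))"
    then show "has_GRR_of_valency_at_most G (18 * group_rank G ^ 2 + 84 * group_rank G)"
      using two[OF _ R(2,1)] symmetric_GRR_valency unfolding R(3) by blast
  next
    fix S assume large: "\<forall>N. \<exists>x \<in> carrier G. order_at_least G x N"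
      and S: "finite S \<and> generating_set G S"
    show "\<exists>T. finite T \<and> S \<subseteq> T \<and> symmetric_set G T \<and> cayley_is_GRR G T \<and>
        card T \<le> 32 * card S ^ 6"
      using six[of S] S large sym by meson
    assume "no_order_4_or_no_char_abelian G"
    then show "\<exists>T. finite T \<and> S \<subseteq> T \<and> symmetric_set G T \<and> cayley_is_GRR G T \<and>
        card T \<le> 18 * card S ^ 2 + 84 * card S"
      using two[of S] S large sym by meson
  qed
qed

end
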